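(* The Hamiltonian systems on $\mathbb R^{6N}$ (with Poisson bracket $\{\cdot,\cdot\}$) generated by $H^x$, $H^y$, $H^t$ are completely integrable in the Liouville sense: $H^x,H^y,H^t$ pairwise Poisson-commute; the $3N$ functions $E_m^{(k)}$ ($k=1,2,3$; $m=0,\dots,N-1$) Poisson-commute pairwise and with each of $H^x,H^y,H^t$ (hence are integrals of motion of all three systems); and these $3N$ functions are functionally independent on a dense open subset of $\mathbb R^{6N}$. Moreover, if $(\Phi_1,\Phi_2,\Phi_3)(x,y,t)$ is a smooth simultaneous solution of the three Hamiltonian systems $$\mathrm{i}\,\phi_{j\alpha,s}=\frac{\partial H^s}{\partial\bar\phi_{j\alpha}},\quad -\mathrm{i}\,\bar\phi_{j\alpha,s}=\frac{\partial H^s}{\partial\phi_{j\alpha}}\qquad(s\in\{x,y,t\}),$$ then $u=\mathrm{i}\langle\Phi_2,\Phi_1\rangle$, $v_1=2|\langle\Phi_3,\Phi_1\rangle|^2$, $v_2=2|\langle\Phi_3,\Phi_2\rangle|^2$ solve the Davey–Stewartson I equation $$-\mathrm{i}u_t=u_{xx}+u_{yy}+2|u|^2u+2(v_1+v_2)u,\qquad v_{1,x}-v_{1,y}=v_{2,x}+v_{2,y}=-(|u|^2)_x .$$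
   Context: Fix $N\ge1$, distinct nonzero real $\lambda_1,\dots,\lambda_N$, $\Lambda=\operatorname{diag}(\lambda_1,\dots,\lambda_N)$. Phase space $\mathbb C^{3N}\cong\mathbb R^{6N}$ with points $(\Phi_1,\Phi_2,\Phi_3)$, $\Phi_j=(\phi_{j1},\dots,\phi_{jN})^T$, real coordinates $\operatorname{Re}\phi_{j\alpha},\operatorname{Im}\phi_{j\alpha}$, Wirtinger derivatives. $\langle V,W\rangle=V^*W$, so $\langle\Phi_i,\Lambda^m\Phi_j\rangle=\sum_\alpha\lambda_\alpha^m\bar\phi_{i\alpha}\phi_{j\alpha}$; $\Omega_j=\langle\Phi_j,\Phi_j\rangle$. Poisson bracket: $\{\xi,\eta\}=-\mathrm{i}\sum_{j,\alpha}\big(\partial_{\phi_{j\alpha}}\xi\,\partial_{\bar\phi_{j\alpha}}\eta-\partial_{\bar\phi_{j\alpha}}\xi\,\partial_{\phi_{j\alpha}}\eta\big)$ (from $\omega=\mathrm{i}\sum d\bar\phi_{j\alpha}\wedge d\phi_{j\alpha}$). $L(\lambda)=C+\sum_\alpha(\lambda-\lambda_\alpha)^{-1}F_\alpha F_\alpha^*$ with $C=\operatorname{diag}(1,-1,0)$, $F_\alpha=(\phi_{1\alpha},\phi_{2\alpha},\phi_{3\alpha})^T$. Define $p_k$ by $\det(\xi I-L(\lambda))=\xi^3-p_1(\lambda)\xi^2+p_2(\lambda)\xi-p_3(\lambda)$ and $E_m^{(k)}$ by $p_k(\lambda)=\sum_{m=-1}^\infty E_m^{(k)}\lambda^{-m-1}$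 for $|\lambda|>\max_\alpha|\lambda_\alpha|$. Hamiltonians: $H^x=-\langle\Phi_1,\Lambda\Phi_1\rangle-\langle\Phi_2,\Lambda\Phi_2\rangle-|\langle\Phi_1,\Phi_3\rangle|^2+|\langle\Phi_2,\Phi_3\rangle|^2$; $H^y=-\langle\Phi_1,\Lambda\Phi_1\rangle+\langle\Phi_2,\Lambda\Phi_2\rangle-|\langle\Phi_1,\Phi_3\rangle|^2-|\langle\Phi_2,\Phi_3\rangle|^2-|\langle\Phi_1,\Phi_2\rangle|^2$; $H^t=2\langle\Phi_1,\Lambda^2\Phi_1\rangle-2\langle\Phi_2,\Lambda^2\Phi_2\rangle+4\operatorname{Re}(\langle\Phi_1,\Phi_3\rangle\langle\Phi_3,\Lambda\Phi_1\rangle)+4\operatorname{Re}(\langle\Phi_2,\Phi_3\rangle\langle\Phi_3,\Lambda\Phi_2\rangle)+4\operatorname{Re}(\langle\Phi_1,\Phi_2\rangle\langle\Phi_2,\Lambda\Phi_1\rangle)+2(\Omega_3-\Omega_1)|\langle\Phi_1,\Phi_3\rangle|^2-2(\Omega_3-\Omega_2)|\langle\Phi_2,\Phi_3\rangle|^2-(\Omega_1-\Omega_2)|\langle\Phi_1,\Phi_2\rangle|^2$. Functional independence means: on a dense open subset of $\mathbb R^{6N}$ the Jacobian of the $3N$ functions with respect to the $6N$ real coordinates has rank $3N$. *)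

theory Defs
  imports "HOL-Analysis.Analysis"
begin

text \<open>Phase space C^{3N}: points z :: complex^'n^3, with z$j$a = phi_{j a}
 (j = 1,2,3 in the numeral type 3, a ranging over the N-element type 'n).
 Lam :: real^'n holds lambda_1..lambda_N.\<close>

definition dd :: "('a::real_normed_vector \<Rightarrow> 'b::real_normed_vector) \<Rightarrow> 'a \<Rightarrow> 'a \<Rightarrow> 'b" where
  "dd f p v = vector_derivative (\<lambda>s::real. f (p + s *\<^sub>R v)) (at 0)"

definition re_dir :: "3 \<Rightarrow> 'n::finite \<Rightarrow> complex^'n^3" where
  "re_dir j a = axis j (axis a 1)"

definition im_dir :: "3 \<Rightarrow> 'n::finite \<Rightarrow> complex^'n^3" where
  "im_dir j a = axis j (axis a \<i>)"

definition dphi :: "(complex^'n^3 \<Rightarrow> complex) \<Rightarrow> complex^'n^3 \<Rightarrow> 3 \<Rightarrow> 'n::finite \<Rightarrow> complex" where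
  "dphi f z j a = (dd f z (re_dir j a) - \<i> * dd f z (im_dir j a)) / 2"

definition dphibar :: "(complex^'n^3 \<Rightarrow> complex) \<Rightarrow> complex^'n^3 \<Rightarrow> 3 \<Rightarrow> 'n::finite \<Rightarrow> complex" where
  "dphibar f z j a = (dd f z (re_dir j a) + \<i> * dd f z (im_dir j a)) / 2"

definition PB :: "(complex^'n^3 \<Rightarrow> complex) \<Rightarrow> (complex^'n^3 \<Rightarrow> complex) \<Rightarrow> complex^'n::finite^3 \<Rightarrow> complex" where
  "PB f g z = - \<i> * (\<Sum>j\<in>UNIV. \<Sum>a\<in>UNIV.
      dphi f z j a * dphibar g z j a - dphibar f z j a * dphi g z j a)"

definition ip :: "real^'n::finite \<Rightarrow> nat \<Rightarrow> complex^'n \<Rightarrow> complex^'n \<Rightarrow> complex" where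
  "ip Lam m V W = (\<Sum>a\<in>UNIV. complex_of_real ((Lam$a) ^ m) * cnj (V$a) * W$a)"

definition Omega :: "real^'n::finite \<Rightarrow> complex^'n^3 \<Rightarrow> 3 \<Rightarrow> complex" where
  "Omega Lam z j = ip Lam 0 (z$j) (z$j)"

definition sqabs :: "complex \<Rightarrow> complex" where
  "sqabs w = complex_of_real ((cmod w)^2)"

definition Hx :: "real^'n::finite \<Rightarrow> complex^'n^3 \<Rightarrow> complex" where
  "Hx Lam z = - ip Lam 1 (z$1) (z$1) - ip Lam 1 (z$2) (z$2)
      - sqabs (ip Lam 0 (z$1) (z$3)) + sqabs (ip Lam 0 (z$2) (z$3))"

definition Hy :: "real^'n::finite \<Rightarrow> complex^'n^3 \<Rightarrow> complex" where
  "Hy Lam z = - ip Lam 1 (z$1) (z$1) + ip Lam 1 (z$2) (z$2)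
      - sqabs (ip Lam 0 (z$1) (z$3)) - sqabs (ip Lam 0 (z$2) (z$3))
      - sqabs (ip Lam 0 (z$1) (z$2))"

definition Ht :: "real^'n::finite \<Rightarrow> complex^'n^3 \<Rightarrow> complex" where
  "Ht Lam z = 2 * ip Lam 2 (z$1) (z$1) - 2 * ip Lam 2 (z$2) (z$2)
      + 4 * complex_of_real (Re (ip Lam 0 (z$1) (z$3) * ip Lam 1 (z$3) (z$1)))
      + 4 * complex_of_real (Re (ip Lam 0 (z$2) (z$3) * ip Lam 1 (z$3) (z$2)))
      + 4 * complex_of_real (Re (ip Lam 0 (z$1) (z$2) * ip Lam 1 (z$2) (z$1)))
      + 2 * (Omega Lam z 3 - Omega Lam z 1) * sqabs (ip Lam 0 (z$1) (z$3))
      - 2 * (Omega Lam z 3 - Omega Lam z 2) * sqabs (ip Lam 0 (z$2) (z$3))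
      - (Omega Lam z 1 - Omega Lam z 2) * sqabs (ip Lam 0 (z$1) (z$2))"

definition Cmat :: "complex^3^3" where
  "Cmat = (\<chi> i j. if i = j then (if i = 1 then 1 else if i = 2 then -1 else 0) else 0)"

definition Lax :: "real^'n::finite \<Rightarrow> complex \<Rightarrow> complex^'n^3 \<Rightarrow> complex^3^3" where
  "Lax Lam lam z = Cmat + (\<chi> i j. \<Sum>a\<in>UNIV. z$i$a * cnj (z$j$a) / (lam - complex_of_real (Lam$a)))"

definition pcoefs :: "real^'n::finite \<Rightarrow> complex \<Rightarrow> complex^'n^3 \<Rightarrow> complex \<times> complex \<times> complex" where
  "pcoefs Lam lam z = (THE (a, b, c). \<forall>xi::complex.
      det (mat xi - Lax Lam lam z) = xi^3 - a * xi^2 + b * xi - c)"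

definition pk :: "real^'n::finite \<Rightarrow> nat \<Rightarrow> complex \<Rightarrow> complex^'n^3 \<Rightarrow> complex" where
  "pk Lam k lam z = (case pcoefs Lam lam z of (a, b, c) \<Rightarrow>
      (if k = 1 then a else if k = 2 then b else c))"

definition Rmax :: "real^'n::finite \<Rightarrow> real" where
  "Rmax Lam = Max (range (\<lambda>a. \<bar>Lam$a\<bar>))"

text \<open>p_k(lam) = sum_{m >= -1} E_m^{(k)} lam^{-m-1} for |lam| > max |lambda_a|;
  the coefficient of lam^{-n} is E_{n-1}, so E_m = c (m+1).\<close>
definition Ecoef :: "real^'n::finite \<Rightarrow> nat \<Rightarrow> nat \<Rightarrow> complex^'n^3 \<Rightarrow> complex" where
  "Ecoef Lam k m z = (THE c :: nat \<Rightarrow> complex. \<forall>lam. Rmax Lam < cmod lam \<longrightarrow>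
      (\<lambda>n. c n / lam ^ n) sums pk Lam k lam z) (m + 1)"

definition idx :: "'n::finite \<Rightarrow> nat" where
  "idx = (SOME f. bij_betw f UNIV {..<CARD('n)})"

definition knum :: "3 \<Rightarrow> nat" where
  "knum i = (if i = 1 then 1 else if i = 2 then 2 else 3)"

definition Emap :: "real^'n::finite \<Rightarrow> complex^'n^3 \<Rightarrow> complex^(3 \<times> 'n)" where
  "Emap Lam z = (\<chi> p. Ecoef Lam (knum (fst p)) (idx (snd p)) z)"

fun Ck :: "nat \<Rightarrow> 'a::real_normed_vector set \<Rightarrow> ('a \<Rightarrow> 'b::real_normed_vector) \<Rightarrow> bool" where
  "Ck 0 U f = continuous_on U f"
| "Ck (Suc k) U f = (\<exists>f'. (\<forall>p\<in>U. (f has_derivative f' p) (at p)) \<and> (\<forall>v. Ck k U (\<lambda>p. f' p v)))"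

definition smooth_on :: "'a::real_normed_vector set \<Rightarrow> ('a \<Rightarrow> 'b::real_normed_vector) \<Rightarrow> bool" where
  "smooth_on U f = (\<forall>k. Ck k U f)"

definition ex :: "real \<times> real \<times> real" where "ex = (1, 0, 0)"
definition ey :: "real \<times> real \<times> real" where "ey = (0, 1, 0)"
definition et :: "real \<times> real \<times> real" where "et = (0, 0, 1)"

definition ham_flow :: "(complex^'n::finite^3 \<Rightarrow> complex) \<Rightarrow> real \<times> real \<times> real \<Rightarrow>
    (real \<times> real \<times> real) set \<Rightarrow> (real \<times> real \<times> real \<Rightarrow> complex^'n^3) \<Rightarrow> bool" where
  "ham_flow H e U F = (\<forall>p\<in>U. \<forall>j a.
      \<i> * dd (\<lambda>q. F q $ j $ a) p e = dphibar H (F p) j a \<and>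
      - \<i> * dd (\<lambda>q. cnj (F q $ j $ a)) p e = dphi H (F p) j a)"

definition DSI :: "(real \<times> real \<times> real) set \<Rightarrow> (real \<times> real \<times> real \<Rightarrow> complex)
    \<Rightarrow> (real \<times> real \<times> real \<Rightarrow> complex) \<Rightarrow> (real \<times> real \<times> real \<Rightarrow> complex) \<Rightarrow> bool" where
  "DSI U u v1 v2 = (\<forall>p\<in>U.
      - \<i> * dd u p et = dd (\<lambda>q. dd u q ex) p ex + dd (\<lambda>q. dd u q ey) p ey
          + 2 * sqabs (u p) * u p + 2 * (v1 p + v2 p) * u p \<and>
      dd v1 p ex - dd v1 p ey = - dd (\<lambda>q. sqabs (u q)) p ex \<and>
      dd v2 p ex + dd v2 p ey = - dd (\<lambda>q. sqabs (u q)) p ex)"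

end

theory Submission
  imports Defs
begin

text \<open>The moments \<open>\<Sum>a. f a * \<phi>\<^sub>i\<^sub>a * cnj \<phi>\<^sub>j\<^sub>a\<close> close under the bracket, which makes the entries of
  the Lax matrix satisfy a linear r-matrix relation. Hence \<open>{L(\<lambda>), p\<^sub>k(\<mu>)}\<close> is a multiple of
  \<open>[Q, L(\<mu>) - L(\<lambda>)]\<close>, where the transposed gradient \<open>Q\<close> of \<open>p\<^sub>k\<close> commutes with \<open>L(\<mu>)\<close>, and
  \<open>{p\<^sub>j(\<lambda>), p\<^sub>k(\<mu>)} = 0\<close> follows by taking a trace. Comparing coefficients in \<open>1/\<lambda>\<close> and then in
  \<open>1/\<mu>\<close>, all \<open>E\<^sub>m\<close> commute; the three Hamiltonians are polynomials in the \<open>E\<^sub>m\<close> with \<open>m \<le> 2\<close>.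

  By the chain rule \<open>dE\<^sub>m\<close> is a coefficient of \<open>tr (Q dL)\<close>. At the point all of whose coordinates
  equal \<open>t\<close> the Jacobian in the directions \<open>Re \<phi>\<^sub>j\<^sub>a\<close> is therefore \<open>t\<close> times a matrix which, as \<open>t\<close>
  tends to 0 and \<open>L\<close> to \<open>C\<close>, tends to the Kronecker product of an invertible 3 by 3 matrix and a
  Vandermonde matrix. So some maximal minor is a nonzero polynomial function, and its zero set has a
  dense complement.

  Along the flows \<open>d/ds f = {f, H}\<close>, which turns the Davey--Stewartson system into bracket
  identities between moments.\<close>

subsection \<open>Function algebras and point derivations\<close>

locale function_algebra =
  fixes P :: "('a \<Rightarrow> 'r::comm_ring_1) \<Rightarrow> bool"
  assumes closed_const: "P (\<lambda>x. c)"
    and closed_add: "P f \<Longrightarrow> P g \<Longrightarrow> P (\<lambda>x. f x + g x)"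
    and closed_mult: "P f \<Longrightarrow> P g \<Longrightarrow> P (\<lambda>x. f x * g x)"
begin

lemma closed_uminus: "P f \<Longrightarrow> P (\<lambda>x. - f x)"
  using closed_mult[OF closed_const[of "-1"]] by fastforce

lemma closed_diff: "P f \<Longrightarrow> P g \<Longrightarrow> P (\<lambda>x. f x - g x)"
  using closed_add[OF _ closed_uminus] by fastforce

lemma closed_sum: "(\<And>i. i \<in> S \<Longrightarrow> P (f i)) \<Longrightarrow> P (\<lambda>x. \<Sum>i\<in>S. f i x)"
  by (induction S rule: infinite_finite_induct) (auto intro: closed_const closed_add)

lemma closed_prod: "(\<And>i. i \<in> S \<Longrightarrow> P (f i)) \<Longrightarrow> P (\<lambda>x. \<Prod>i\<in>S. f i x)"
  by (induction S rule: infinite_finite_induct) (auto intro: closed_const closed_mult)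

lemmas closed_intros = closed_const closed_add closed_mult closed_uminus closed_diff closed_sum

lemma closed_det: "(\<And>i j. P (\<lambda>x. A x $ i $ j)) \<Longrightarrow> P (\<lambda>x. det (A x :: 'r^'n^'n))"
  unfolding det_def by (intro closed_sum closed_mult closed_const closed_prod)

lemma function_algebra_fps: "function_algebra (\<lambda>f. \<forall>n. P (\<lambda>x. fps_nth (f x) n))"
  by unfold_locales (auto simp: fps_mult_nth intro!: closed_intros)

end

locale point_derivation = function_algebra P
  for P :: "('a \<Rightarrow> 'r::comm_ring_1) \<Rightarrow> bool" +
  fixes z :: 'a and D :: "('a \<Rightarrow> 'r) \<Rightarrow> 'r"
  assumes const: "D (\<lambda>x. c) = 0"
    and add: "P f \<Longrightarrow> P g \<Longrightarrow> D (\<lambda>x. f x + g x) = D f + D g"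
    and mult: "P f \<Longrightarrow> P g \<Longrightarrow> D (\<lambda>x. f x * g x) = f z * D g + D f * g z"
begin

lemma uminus: "P f \<Longrightarrow> D (\<lambda>x. - f x) = - D f"
  using mult[OF closed_const[of "-1"], of f] by (simp add: const)

lemma diff: "P f \<Longrightarrow> P g \<Longrightarrow> D (\<lambda>x. f x - g x) = D f - D g"
  using add[of f "\<lambda>x. - g x"] by (simp add: uminus closed_uminus)

lemma sum: "(\<And>i. i \<in> S \<Longrightarrow> P (f i)) \<Longrightarrow> D (\<lambda>x. \<Sum>i\<in>S. f i x) = (\<Sum>i\<in>S. D (f i))"
  by (induction S rule: infinite_finite_induct) (auto simp: const add closed_sum)

lemmas rules = const add mult uminus diff sum

lemma point_derivation_fps:
  "point_derivation (\<lambda>f. \<forall>n. P (\<lambda>x. fps_nth (f x) n)) z (\<lambda>f. Abs_fps (\<lambda>n. D (\<lambda>x. fps_nth (f x) n)))"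
proof (intro point_derivation.intro point_derivation_axioms.intro function_algebra_fps)
  fix f g :: "'a \<Rightarrow> 'r fps"
  assume "\<forall>n. P (\<lambda>x. fps_nth (f x) n)" "\<forall>n. P (\<lambda>x. fps_nth (g x) n)"
  then show "Abs_fps (\<lambda>n. D (\<lambda>x. fps_nth (f x + g x) n)) =
      Abs_fps (\<lambda>n. D (\<lambda>x. fps_nth (f x) n)) + Abs_fps (\<lambda>n. D (\<lambda>x. fps_nth (g x) n))"
    and "Abs_fps (\<lambda>n. D (\<lambda>x. fps_nth (f x * g x) n)) =
      f z * Abs_fps (\<lambda>n. D (\<lambda>x. fps_nth (g x) n)) + Abs_fps (\<lambda>n. D (\<lambda>x. fps_nth (f x) n)) * g z"
    by (simp_all add: fps_eq_iff fps_mult_nth add mult sum closed_mult sum.distrib)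
qed (simp add: fps_eq_iff const)

end

subsection \<open>Polynomial functions\<close>

lemma polynomial_function_times:
  fixes f g :: "'a::real_normed_vector \<Rightarrow> 'b::{real_normed_algebra, euclidean_space}"
  assumes "polynomial_function f" "polynomial_function g"
  shows "polynomial_function (\<lambda>x. f x * g x)"
proof -
  have expand: "f x * g x = (\<Sum>b\<in>Basis. \<Sum>c\<in>Basis. (f x \<bullet> b) *\<^sub>R (g x \<bullet> c) *\<^sub>R (b * c))" for x
  proof -
    have "f x * g x = (\<Sum>b\<in>Basis. (f x \<bullet> b) *\<^sub>R b) * (\<Sum>c\<in>Basis. (g x \<bullet> c) *\<^sub>R c)"
      by (simp only: euclidean_representation)
    also have "\<dots> = (\<Sum>b\<in>Basis. \<Sum>c\<in>Basis. (f x \<bullet> b) *\<^sub>R (g x \<bullet> c) *\<^sub>R (b * c))"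
      unfolding sum_product by (simp add: mult.commute)
    finally show ?thesis .
  qed
  show ?thesis
    unfolding expand using assms
    by (intro polynomial_function_sum polynomial_function_mult polynomial_function_inner
        polynomial_function_const finite_Basis)
qed

interpretation polynomial: function_algebra
  "polynomial_function ::
    ('a::real_normed_vector \<Rightarrow> 'b::{real_normed_algebra, comm_ring_1, euclidean_space}) \<Rightarrow> bool"
  by unfold_locales (auto intro: polynomial_function_times)

lemma polynomial_function_vec_nth:
  fixes f :: "'a::real_normed_vector \<Rightarrow> 'b::real_normed_vector^'n"
  shows "polynomial_function f \<Longrightarrow> polynomial_function (\<lambda>x. f x $ i)"
  using polynomial_function_compose
    [OF _ polynomial_function_bounded_linear[OF bounded_linear_vec_nth]]
  by (simp add: o_def)

lemma polynomial_function_cnj: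
  "polynomial_function f \<Longrightarrow> polynomial_function (\<lambda>x. cnj (f x))"
  using polynomial_function_compose
    [OF _ polynomial_function_bounded_linear[OF bounded_linear_cnj]]
  by (simp add: o_def)

declare polynomial.closed_intros [simp] polynomial_function_vec_nth [simp]
  polynomial_function_cnj [simp] differentiable_at_polynomial_function [simp]

lemma real_polynomial_function_zeros_finite:
  fixes p :: "real \<Rightarrow> real"
  assumes "real_polynomial_function p" "p x \<noteq> 0"
  shows "finite {t. p t = 0}"
proof -
  obtain c n where p: "p = (\<lambda>t. \<Sum>i\<le>n. c i * t ^ i)"
    using assms(1) real_polynomial_function_imp_sum by blast
  with assms(2) obtain k where "k \<le> n" "c k \<noteq> 0"
    by (fastforce simp: p intro: sum.neutral)
  then show ?thesis unfolding p by (blast intro: polyfun_rootbound_finite)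
qed

lemma nonzero_polynomial_function_dense:
  fixes f :: "'a::real_normed_vector \<Rightarrow> 'b::euclidean_space"
  assumes f: "polynomial_function f" and "f w \<noteq> 0"
  shows "closure {z. f z \<noteq> 0} = UNIV"
proof (rule UNIV_eq_I[symmetric])
  fix z
  obtain b where b: "b \<in> Basis" "f w \<bullet> b \<noteq> 0"
    using \<open>f w \<noteq> 0\<close> by (metis euclidean_all_zero_iff)
  define line where "line t = z + t *\<^sub>R (w - z)" for t :: real
  have "polynomial_function line"
    unfolding line_def[abs_def] by (intro polynomial_function_add polynomial_function_mult) auto
  then have "real_polynomial_function ((\<lambda>z. f z \<bullet> b) \<circ> line)"
    using f b(1) unfolding polynomial_function_iff_Basis_inner
    by (intro real_polynomial_function_compose) blast+
  then have fin: "finite {t. f (line t) \<bullet> b = 0}"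
    using b(2) real_polynomial_function_zeros_finite[of _ 1] by (simp add: line_def o_def)
  have "(line \<longlongrightarrow> line 0) (at 0)"
    unfolding line_def by (intro tendsto_intros)
  moreover have "\<forall>\<^sub>F t in at 0. f (line t) \<noteq> 0"
  proof -
    have "\<forall>\<^sub>F t in at 0. t \<notin> {t. f (line t) \<bullet> b = 0}"
      using islimpt_finite[OF fin] by (simp add: islimpt_iff_eventually)
    then show ?thesis by eventually_elim auto
  qed
  ultimately show "z \<in> closure {z. f z \<noteq> 0}"
    by (intro Lim_in_closed_set[of "closure {z. f z \<noteq> 0}" line "at 0"])
      (auto simp: line_def elim!: eventually_mono intro: closure_subset[THEN subsetD])
qed

subsection \<open>Directional derivatives\<close>

lemma has_derivative_imp_dd:
  assumes "(f has_derivative f') (at z)"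
  shows "dd f z v = f' v"
proof -
  have line: "((\<lambda>s::real. z + s *\<^sub>R v) has_derivative (\<lambda>s. s *\<^sub>R v)) (at 0)"
    by (auto intro!: derivative_eq_intros)
  have "((\<lambda>s::real. f (z + s *\<^sub>R v)) has_derivative (\<lambda>s. f' (s *\<^sub>R v))) (at 0)"
    using has_derivative_compose[OF line, of f f'] assms by simp
  then have "((\<lambda>s::real. f (z + s *\<^sub>R v)) has_vector_derivative f' v) (at 0)"
    using has_derivative_linear[OF assms]
    by (simp add: has_vector_derivative_def linear_cmul)
  then show ?thesis unfolding dd_def by (rule vector_derivative_at)
qed

lemma differentiable_has_derivative_dd:
  "f differentiable (at z) \<Longrightarrow> (f has_derivative dd f z) (at z)"
  unfolding differentiable_def by (metis ext has_derivative_imp_dd)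

lemma linear_dd: "f differentiable (at z) \<Longrightarrow> linear (dd f z)"
  using differentiable_has_derivative_dd has_derivative_linear by blast

lemma dd_bounded_linear: "bounded_linear f \<Longrightarrow> dd f z v = f v"
  by (rule has_derivative_imp_dd[OF bounded_linear_imp_has_derivative])

interpretation dd: point_derivation
  "\<lambda>f :: 'a::real_normed_vector \<Rightarrow> 'b::real_normed_field. f differentiable (at z)" z
  "\<lambda>f. dd f z v" for z v
  by unfold_locales
    (auto intro!: has_derivative_imp_dd has_derivative_add has_derivative_mult
      differentiable_has_derivative_dd)

lemma dd_compose:
  assumes "f differentiable (at (F p))" "(F has_derivative F') (at p)"
  shows "dd (\<lambda>q. f (F q)) p e = dd f (F p) (F' e)"
  using has_derivative_compose[OF assms(2) differentiable_has_derivative_dd[OF assms(1)]]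
  by (rule has_derivative_imp_dd)

lemma dd_cong_open:
  assumes "open U" "p \<in> U" "\<And>q. q \<in> U \<Longrightarrow> f q = g q"
  shows "dd f p e = dd g p e"
proof -
  have "((\<lambda>s::real. p + s *\<^sub>R e) \<longlongrightarrow> p + 0 *\<^sub>R e) (nhds 0)"
    by (intro tendsto_intros) (simp add: filterlim_ident)
  then have "\<forall>\<^sub>F s in nhds 0. p + s *\<^sub>R e \<in> U"
    using assms(1,2) topological_tendstoD by fastforce
  then have "\<forall>\<^sub>F s in nhds 0. s \<in> UNIV \<longrightarrow> f (p + s *\<^sub>R e) = g (p + s *\<^sub>R e)"
    by eventually_elim (simp add: assms(3))
  then show ?thesis
    unfolding dd_def by (intro vector_derivative_cong_eq) simp_all
qed

lemma Im_dd_eq_0_if_real_valued: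
  assumes "f differentiable (at z)" "\<And>x. Im (f x) = 0"
  shows "Im (dd f z v) = 0"
proof -
  have "((\<lambda>x. Im (f x)) has_derivative (\<lambda>v. Im (dd f z v))) (at z)"
    by (intro has_derivative_Im differentiable_has_derivative_dd assms(1))
  then have "((\<lambda>x. 0) has_derivative (\<lambda>v. Im (dd f z v))) (at z)"
    by (simp add: assms(2))
  then show ?thesis
    by (metis dd.const has_derivative_imp_dd)
qed

lemma has_derivative_vec_lambda:
  fixes f :: "'p::finite \<Rightarrow> 'a::real_normed_vector \<Rightarrow> 'b::euclidean_space"
  assumes "\<And>p. (f p has_derivative f' p) (at z)"
  shows "((\<lambda>z. \<chi> p. f p z) has_derivative (\<lambda>v. \<chi> p. f' p v)) (at z)"
proof (subst has_derivative_componentwise_within, rule ballI)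
  fix i :: "'b^'p" assume "i \<in> Basis"
  then obtain p b where i: "i = axis p b" by (auto simp: Basis_vec_def)
  show "((\<lambda>z. (\<chi> p. f p z) \<bullet> i) has_derivative (\<lambda>v. (\<chi> p. f' p v) \<bullet> i)) (at z)"
    unfolding i inner_axis vec_lambda_beta by (rule has_derivative_inner_left[OF assms])
qed

lemma polynomial_function_dd:
  fixes f :: "'a::real_normed_vector \<Rightarrow> 'b::euclidean_space"
  assumes "polynomial_function f"
  shows "polynomial_function (\<lambda>z. dd f z v)"
proof -
  have real_case: "real_polynomial_function (\<lambda>z. dd g z v)"
    if "real_polynomial_function g" for g :: "'a \<Rightarrow> real"
    using that
    by induction
      (simp_all add: dd_bounded_linear dd.rules differentiable_at_real_polynomial_function
        real_polynomial_function.intros)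
  have "dd f z v \<bullet> b = dd (\<lambda>z. f z \<bullet> b) z v" for z b
    by (rule has_derivative_imp_dd[symmetric])
      (intro has_derivative_inner_left differentiable_has_derivative_dd
        differentiable_at_polynomial_function assms)
  with assms show ?thesis
    by (simp add: polynomial_function_iff_Basis_inner real_case)
qed

subsection \<open>Wirtinger derivatives and the Poisson bracket\<close>

lemma dd_coord: "dd (\<lambda>z::complex^'n::finite^3. z$j$a) z v = v$j$a"
  by (intro dd_bounded_linear bounded_linear_vec_nth[THEN bounded_linear_compose]
      bounded_linear_vec_nth)

lemma dd_cnj_coord: "dd (\<lambda>z::complex^'n::finite^3. cnj (z$j$a)) z v = cnj (v$j$a)"
  by (intro dd_bounded_linear bounded_linear_cnj[THEN bounded_linear_compose]
      bounded_linear_vec_nth[THEN bounded_linear_compose] bounded_linear_vec_nth)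

interpretation dphi: point_derivation
  "\<lambda>f. f differentiable (at z)" z "\<lambda>f. dphi f z j a" for z j a
  by unfold_locales
    (simp_all add: dphi_def dd.rules algebra_simps add_divide_distrib diff_divide_distrib)

interpretation dphibar: point_derivation
  "\<lambda>f. f differentiable (at z)" z "\<lambda>f. dphibar f z j a" for z j a
  by unfold_locales
    (simp_all add: dphibar_def dd.rules algebra_simps add_divide_distrib diff_divide_distrib)

lemma sum_sum_delta:
  "(\<Sum>j\<in>UNIV. \<Sum>a\<in>UNIV. if j = k \<and> a = b then f j a else 0) = f (k::'a::finite) (b::'b::finite)"
  for f :: "_ \<Rightarrow> _ \<Rightarrow> 'c::comm_monoid_add"
proof -
  have "(\<Sum>a\<in>UNIV. if j = k \<and> a = b then f j a else 0) = (if j = k then f j b else 0)" for j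
    by (cases "j = k") auto
  then show ?thesis by simp
qed

lemma phase_vector_expansion:
  fixes v :: "complex^'n::finite^3"
  shows "v = (\<Sum>j\<in>UNIV. \<Sum>a\<in>UNIV. Re (v$j$a) *\<^sub>R re_dir j a + Im (v$j$a) *\<^sub>R im_dir j a)"
proof -
  have "(Re (v$j$a) *\<^sub>R re_dir j a + Im (v$j$a) *\<^sub>R im_dir j a) $ k $ b =
      (if j = k \<and> a = b then v$j$a else 0)" for j k a b
    by (auto simp: re_dir_def im_dir_def axis_def complex_eq_iff)
  then show ?thesis
    unfolding vec_eq_iff by (simp only: sum_component sum_sum_delta simp_thms)
qed

lemma dd_Wirtinger:
  fixes f :: "complex^'n::finite^3 \<Rightarrow> complex"
  assumes f: "f differentiable (at z)"
  shows "dd f z v = (\<Sum>j\<in>UNIV. \<Sum>a\<in>UNIV. dphi f z j a * v$j$a + dphibar f z j a * cnj (v$j$a))"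
proof -
  note lin = linear_dd[OF f]
  have "dd f z v = (\<Sum>j\<in>UNIV. \<Sum>a\<in>UNIV.
      Re (v$j$a) *\<^sub>R dd f z (re_dir j a) + Im (v$j$a) *\<^sub>R dd f z (im_dir j a))"
    using arg_cong[OF phase_vector_expansion[of v], of "dd f z"]
    by (simp only: linear_sum[OF lin] linear_add[OF lin] linear_cmul[OF lin])
  also have "\<dots> = (\<Sum>j\<in>UNIV. \<Sum>a\<in>UNIV. dphi f z j a * v$j$a + dphibar f z j a * cnj (v$j$a))"
    by (intro sum.cong refl) (simp add: dphi_def dphibar_def complex_eq_iff field_simps)
  finally show ?thesis .
qed

lemma PB_antisym: "PB f g z = - PB g f z"
  unfolding PB_def by (simp add: sum_subtractf algebra_simps)

interpretation PB_left: point_derivation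
  "\<lambda>f. f differentiable (at z)" z "\<lambda>f. PB f h z" for z h
  by unfold_locales
    (simp_all add: PB_def dphi.rules dphibar.rules algebra_simps sum.distrib sum_subtractf
      sum_distrib_left)

interpretation PB_right: point_derivation
  "\<lambda>f. f differentiable (at z)" z "\<lambda>f. PB h f z" for z h
  unfolding PB_antisym[of h]
  by unfold_locales (simp_all add: PB_left.rules)

definition moment :: "('n::finite \<Rightarrow> complex) \<Rightarrow> 3 \<Rightarrow> 3 \<Rightarrow> complex^'n^3 \<Rightarrow> complex" where
  "moment f i j z = (\<Sum>a\<in>UNIV. f a * (z$i$a * cnj (z$j$a)))"

lemma polynomial_function_moment [simp]: "polynomial_function (moment f i j)"
  unfolding moment_def[abs_def] by simp

lemma Wirtinger_coord:
  shows "dphi (\<lambda>z::complex^'n::finite^3. z$k$b) z j a = (if j = k \<and> a = b then 1 else 0)"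
    and "dphibar (\<lambda>z::complex^'n::finite^3. z$k$b) z j a = 0"
    and "dphi (\<lambda>z::complex^'n::finite^3. cnj (z$k$b)) z j a = 0"
    and "dphibar (\<lambda>z::complex^'n::finite^3. cnj (z$k$b)) z j a = (if j = k \<and> a = b then 1 else 0)"
  by (auto simp: dphi_def dphibar_def dd_coord dd_cnj_coord re_dir_def im_dir_def axis_def)

lemma Wirtinger_moment:
  shows "dphi (moment f i j) z k b = (if k = i then f b * cnj (z$j$b) else 0)"
    and "dphibar (moment f i j) z k b = (if k = j then f b * z$i$b else 0)"
  by (simp_all add: moment_def[abs_def] dphi.rules dphibar.rules Wirtinger_coord if_distrib
      if_distribR cong: if_cong)

lemma PB_moment:
  "PB (moment f i j) (moment g k l) z =
    - \<i> * ((if i = l then moment (\<lambda>a. f a * g a) k j z else 0) -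
           (if j = k then moment (\<lambda>a. f a * g a) i l z else 0))"
proof -
  have "(\<Sum>j'\<in>UNIV. \<Sum>a\<in>UNIV. (if j' = p then F a else 0) * (if j' = q then G a else 0)) =
      (if p = q then \<Sum>a\<in>UNIV. F a * G a else 0)"
    for p q :: 3 and F G :: "'a \<Rightarrow> complex"
  proof -
    have "(\<Sum>a\<in>UNIV. (if j' = p then F a else 0) * (if j' = q then G a else 0)) =
        (if j' = p then if p = q then \<Sum>a\<in>UNIV. F a * G a else 0 else 0)" for j'
      by auto
    then show ?thesis by simp
  qed
  then show ?thesis
    unfolding PB_def Wirtinger_moment sum_subtractf moment_def
    by (auto simp: mult_ac)
qed

lemma dd_moment:
  "dd (moment f i j) z v = (\<Sum>a\<in>UNIV. f a * (z$i$a * cnj (v$j$a) + v$i$a * cnj (z$j$a)))"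
  by (simp add: moment_def[abs_def] dd.rules dd_coord dd_cnj_coord)

subsection \<open>Characteristic coefficients of a matrix\<close>

definition char_coeff :: "nat \<Rightarrow> 'a::comm_ring_1^3^3 \<Rightarrow> 'a" where
  "char_coeff k A = (if k = 1 then trace A
    else if k = 2 then A$1$1 * A$2$2 - A$1$2 * A$2$1 + (A$1$1 * A$3$3 - A$1$3 * A$3$1)
      + (A$2$2 * A$3$3 - A$2$3 * A$3$2)
    else det A)"

text \<open>The transposed gradient of \<^const>\<open>char_coeff\<close>; for the determinant this is the adjugate, written
  with the Cayley--Hamilton formula so that it visibly commutes with its argument.\<close>
definition char_coeff_grad :: "nat \<Rightarrow> 'a::comm_ring_1^3^3 \<Rightarrow> 'a^3^3" where
  "char_coeff_grad k A = (if k = 1 then mat 1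
    else if k = 2 then mat (trace A) - A
    else A ** A - mat (trace A) ** A + mat (char_coeff 2 A))"

lemma charpoly_eq_char_coeff:
  fixes A :: "'a::comm_ring_1^3^3"
  shows "det (mat xi - A) = xi^3 - char_coeff 1 A * xi^2 + char_coeff 2 A * xi - char_coeff 3 A"
  by (simp add: det_3 char_coeff_def trace_def sum_3 mat_def algebra_simps power3_eq_cube
      power2_eq_square)

lemma char_coeff_adjoint: "char_coeff k (\<chi> i j. cnj (A $ j $ i)) = cnj (char_coeff k A)"
  by (simp add: char_coeff_def trace_def det_3 sum_3 algebra_simps)

lemma matrix_diff_ldistrib: "A ** (B - C) = A ** B - A ** C" for A :: "'a::ring_1^'n^'m"
  by (simp add: vec_eq_iff matrix_matrix_mult_def right_diff_distrib sum_subtractf)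

lemma matrix_diff_rdistrib: "(B - C) ** A = B ** A - C ** A" for A :: "'a::ring_1^'n^'m"
  by (simp add: vec_eq_iff matrix_matrix_mult_def left_diff_distrib sum_subtractf)

lemma matrix_add_rdistrib: "(B + C) ** A = B ** A + C ** A" for A :: "'a::semiring_1^'n^'m"
  by (simp add: vec_eq_iff matrix_matrix_mult_def distrib_right sum.distrib)

lemma mat_mult_nth: "(mat c ** A) $ i $ j = c * A $ i $ j" for A :: "'a::semiring_1^'n^'m"
  by (simp add: matrix_matrix_mult_def mat_def if_distrib if_distribR cong: if_cong)

lemma trace_mat_mult: "trace (mat c ** A) = c * trace A" for A :: "'a::semiring_1^'n^'n"
  by (simp add: trace_def mat_mult_nth sum_distrib_left)

lemma mat_mult_commute: "mat c ** A = A ** mat c" for A :: "'a::comm_semiring_1^'n^'n"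
  by (simp add: vec_eq_iff mat_mult_nth)
    (simp add: matrix_matrix_mult_def mat_def if_distrib mult.commute cong: if_cong)

lemma char_coeff_grad_commute: "char_coeff_grad k A ** A = A ** char_coeff_grad k A"
proof -
  have "A ** (mat c ** A) = mat c ** A ** A" for c
    by (metis mat_mult_commute matrix_mul_assoc)
  then show ?thesis
    unfolding char_coeff_grad_def
    by (simp add: matrix_add_ldistrib matrix_add_rdistrib matrix_diff_ldistrib matrix_diff_rdistrib
        matrix_mul_assoc mat_mult_commute)
qed

lemma trace_commutator_eq_0:
  fixes P Q L M :: "'a::comm_ring_1^'n^'n"
  assumes "P ** L = L ** P" "Q ** M = M ** Q"
  shows "trace (P ** (Q ** (M - L) - (M - L) ** Q)) = 0"
proof -
  have "trace (P ** (Q ** L)) = trace (L ** (P ** Q))"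
    by (metis matrix_mul_assoc trace_mul_sym)
  also have "\<dots> = trace (P ** (L ** Q))"
    by (metis assms(1) matrix_mul_assoc)
  finally show ?thesis
    by (simp add: matrix_diff_ldistrib matrix_diff_rdistrib trace_sub assms(2))
qed

context function_algebra
begin

lemma closed_trace: "(\<And>i j. P (\<lambda>x. A x $ i $ j)) \<Longrightarrow> P (\<lambda>x. trace (A x :: 'r^'n^'n))"
  unfolding trace_def by (intro closed_sum)

lemma closed_char_coeff:
  assumes "\<And>i j. P (\<lambda>x. A x $ i $ j)"
  shows "P (\<lambda>x. char_coeff k (A x))"
  unfolding char_coeff_def using assms
  by (cases "k = 1"; cases "k = 2") (simp_all add: closed_trace closed_det closed_intros)

lemma closed_char_coeff_grad:
  assumes "\<And>i j. P (\<lambda>x. A x $ i $ j)"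
  shows "P (\<lambda>x. char_coeff_grad k (A x) $ i $ j)"
proof -
  have "P (\<lambda>x. mat (f x) $ i $ j)" if "P f" for f and i j :: 3
    using that by (cases "i = j") (simp_all add: mat_def closed_const)
  moreover have "P (\<lambda>x. (A x ** A x) $ i $ j)" for i j
    using assms by (simp add: matrix_matrix_mult_def closed_sum closed_mult)
  ultimately show ?thesis
    using assms unfolding char_coeff_grad_def
    by (cases "k = 1"; cases "k = 2")
      (simp_all add: mat_mult_nth closed_trace closed_char_coeff closed_intros)
qed

end

lemma (in point_derivation) char_coeff:
  fixes A :: "'a \<Rightarrow> 'r^3^3"
  assumes "\<And>i j. P (\<lambda>x. A x $ i $ j)"
  shows "D (\<lambda>x. char_coeff k (A x)) =
    trace (char_coeff_grad k (A z) ** (\<chi> i j. D (\<lambda>x. A x $ i $ j)))"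
proof -
  consider (trace) "k = 1" | (minors) "k = 2" | (det) "k \<noteq> 1" "k \<noteq> 2" by blast
  then show ?thesis
  proof cases
    case trace
    then show ?thesis
      using assms by (simp add: char_coeff_def char_coeff_grad_def trace_def rules)
  next
    case minors
    then show ?thesis
      using assms
      by (simp add: char_coeff_def char_coeff_grad_def matrix_diff_rdistrib trace_sub
          trace_mat_mult)
        (simp add: trace_def matrix_matrix_mult_def sum_3 rules closed_intros algebra_simps)
  next
    case det
    then show ?thesis
      using assms
      by (simp add: char_coeff_def char_coeff_grad_def matrix_diff_rdistrib matrix_add_rdistrib
          trace_sub trace_add trace_mat_mult matrix_mul_assoc[symmetric])
        (simp add: trace_def det_3 matrix_matrix_mult_def sum_3 rules closed_intros algebra_simps)
  qed
qed

subsection \<open>The r-matrix relation\<close>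

lemma pk_eq_char_coeff: "pk Lam k lam z = char_coeff k (Lax Lam lam z)"
proof -
  let ?A = "Lax Lam lam z"
  have "pcoefs Lam lam z = (char_coeff 1 ?A, char_coeff 2 ?A, char_coeff 3 ?A)"
    unfolding pcoefs_def
  proof (rule the_equality)
    show "case (char_coeff 1 ?A, char_coeff 2 ?A, char_coeff 3 ?A) of (a, b, c) \<Rightarrow>
        \<forall>xi. det (mat xi - ?A) = xi^3 - a * xi^2 + b * xi - c"
      by (simp add: charpoly_eq_char_coeff)
  next
    fix abc :: "complex \<times> complex \<times> complex"
    assume det: "case abc of (a, b, c) \<Rightarrow> \<forall>xi. det (mat xi - ?A) = xi^3 - a * xi^2 + b * xi - c"
    obtain a b c where abc: "abc = (a, b, c)" by (cases abc)
    have "xi^3 - char_coeff 1 ?A * xi^2 + char_coeff 2 ?A * xi - char_coeff 3 ?A =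
        xi^3 - a * xi^2 + b * xi - c" for xi
      using det by (simp add: abc charpoly_eq_char_coeff)
    from this[of 0] this[of 1] this[of "-1"]
    show "abc = (char_coeff 1 ?A, char_coeff 2 ?A, char_coeff 3 ?A)"
      by (auto simp: abc complex_eq_iff)
  qed
  then show ?thesis by (simp add: pk_def char_coeff_def)
qed

lemma Lax_nth:
  "Lax Lam lam z $ i $ j = Cmat $ i $ j + moment (\<lambda>a. 1 / (lam - of_real (Lam$a))) i j z"
  by (simp add: Lax_def moment_def)

lemma polynomial_function_Lax [simp]: "polynomial_function (\<lambda>z. Lax Lam lam z $ i $ j)"
  unfolding Lax_nth by simp

lemma PB_Lax:
  fixes Lam :: "real^'n::finite"
  assumes "lam \<notin> range (\<lambda>a. of_real (Lam$a))" "mu \<notin> range (\<lambda>a. of_real (Lam$a))" "lam \<noteq> mu"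
  shows "PB (\<lambda>z. Lax Lam lam z $ i $ j) (\<lambda>z. Lax Lam mu z $ k $ l) z =
    - \<i> / (lam - mu) * ((if i = l then (Lax Lam mu z - Lax Lam lam z) $ k $ j else 0) -
      (if j = k then (Lax Lam mu z - Lax Lam lam z) $ i $ l else 0))"
proof -
  have "1 / (lam - of_real (Lam$a)) * (1 / (mu - of_real (Lam$a)))
      = (1 / (mu - of_real (Lam$a)) - 1 / (lam - of_real (Lam$a))) / (lam - mu)" for a
    using assms by (auto simp: divide_simps)
  then have resolvent:
    "moment (\<lambda>a. 1 / (lam - of_real (Lam$a)) * (1 / (mu - of_real (Lam$a)))) i j z =
      (Lax Lam mu z - Lax Lam lam z) $ i $ j / (lam - mu)" for i j z
    by (simp add: Lax_nth moment_def sum_subtractf left_diff_distrib diff_divide_distrib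
        sum_divide_distrib del: divide_divide_eq_left)
  have "PB (\<lambda>z. Lax Lam lam z $ i $ j) (\<lambda>z. Lax Lam mu z $ k $ l) z =
      PB (moment (\<lambda>a. 1 / (lam - of_real (Lam$a))) i j)
        (moment (\<lambda>a. 1 / (mu - of_real (Lam$a))) k l) z"
    by (simp add: Lax_nth PB_left.rules PB_right.rules)
  then show ?thesis
    unfolding PB_moment resolvent by (simp add: diff_divide_distrib right_diff_distrib)
qed

lemma PB_char_coeff_Lax:
  fixes Lam :: "real^'n::finite"
  assumes "lam \<notin> range (\<lambda>a. of_real (Lam$a))" "mu \<notin> range (\<lambda>a. of_real (Lam$a))" "lam \<noteq> mu"
  shows "PB (\<lambda>z. char_coeff k (Lax Lam lam z)) (\<lambda>z. char_coeff k' (Lax Lam mu z)) z = 0"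
proof -
  define L M where "L = Lax Lam lam z" and "M = Lax Lam mu z"
  define Q where "Q = char_coeff_grad k' M"
  define B where "B = Q ** (M - L) - (M - L) ** Q"
  define s where "s = - \<i> / (lam - mu)"
  have PB_entry: "PB (\<lambda>z. Lax Lam lam z $ i $ j) (\<lambda>z. char_coeff k' (Lax Lam mu z)) z =
      s * B $ i $ j" for i j
  proof -
    have "PB (\<lambda>z. Lax Lam lam z $ i $ j) (\<lambda>z. char_coeff k' (Lax Lam mu z)) z =
        trace (Q ** (\<chi> k l. s * ((if i = l then (M - L) $ k $ j else 0)
          - (if j = k then (M - L) $ i $ l else 0))))"
      unfolding Q_def L_def M_def s_def
      by (simp only: PB_Lax[OF assms]
          PB_right.char_coeff[OF differentiable_at_polynomial_function[OF polynomial_function_Lax]])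
    also have "\<dots> = s * B $ i $ j"
      using exhaust_3[of i] exhaust_3[of j]
      by (auto simp: B_def trace_def sum_3 matrix_matrix_mult_def algebra_simps)
    finally show ?thesis .
  qed
  have "PB (\<lambda>z. char_coeff k (Lax Lam lam z)) (\<lambda>z. char_coeff k' (Lax Lam mu z)) z =
      trace (char_coeff_grad k L ** (\<chi> i j. s * B $ i $ j))"
    by (simp add: PB_left.char_coeff PB_entry L_def)
  also have "\<dots> = s * trace (char_coeff_grad k L ** B)"
    by (simp add: trace_def matrix_matrix_mult_def sum_distrib_left mult_ac)
  finally show ?thesis
    by (simp add: B_def Q_def trace_commutator_eq_0 char_coeff_grad_commute)
qed

subsection \<open>Laurent expansions at infinity\<close>

definition laurent_at_infinity :: "real \<Rightarrow> complex fps \<Rightarrow> (complex \<Rightarrow> complex) \<Rightarrow> bool" where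
  "laurent_at_infinity R A w \<longleftrightarrow> (\<forall>lam. R < cmod lam \<longrightarrow>
     ereal (cmod (1 / lam)) < fps_conv_radius A \<and> eval_fps A (1 / lam) = w lam)"

lemma laurent_at_infinity_iff_sums:
  assumes "R \<ge> 0"
  shows "laurent_at_infinity R A w \<longleftrightarrow>
    (\<forall>lam. R < cmod lam \<longrightarrow> (\<lambda>n. fps_nth A n / lam ^ n) sums w lam)"
proof (intro iffI allI impI)
  fix lam assume "laurent_at_infinity R A w" "R < cmod lam"
  then show "(\<lambda>n. fps_nth A n / lam ^ n) sums w lam"
    using sums_eval_fps[of "1 / lam" A] by (simp add: laurent_at_infinity_def power_one_over)
next
  assume sums: "\<forall>lam. R < cmod lam \<longrightarrow> (\<lambda>n. fps_nth A n / lam ^ n) sums w lam"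
  show "laurent_at_infinity R A w"
    unfolding laurent_at_infinity_def
  proof (intro allI impI conjI)
    fix lam assume "R < cmod lam"
    then obtain r where r: "R < r" "r < cmod lam" using dense by blast
    with \<open>R \<ge> 0\<close> have "r > 0" by linarith
    have "summable (\<lambda>n. fps_nth A n * (1 / of_real r) ^ n)"
      using sums[rule_format, of "of_real r"] r \<open>r > 0\<close>
      by (auto simp: sums_iff power_one_over)
    then have "ereal (cmod (1 / of_real r)) \<le> fps_conv_radius A"
      unfolding fps_conv_radius_def by (rule conv_radius_geI)
    moreover have "cmod (1 / lam) < cmod (1 / of_real r)"
      using r \<open>r > 0\<close> by (simp add: norm_divide frac_less2)
    ultimately show "ereal (cmod (1 / lam)) < fps_conv_radius A"
      by (meson ereal_less_le less_ereal.simps(1) order_less_le_trans)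
    show "eval_fps A (1 / lam) = w lam"
      using sums[rule_format, OF \<open>R < cmod lam\<close>]
      by (simp add: eval_fps_def sums_iff power_one_over)
  qed
qed

lemma laurent_at_infinity_mono: "laurent_at_infinity R A w \<Longrightarrow> R \<le> R' \<Longrightarrow> laurent_at_infinity R' A w"
  by (auto simp: laurent_at_infinity_def)

lemma laurent_at_infinity_const: "laurent_at_infinity R (fps_const c) (\<lambda>lam. c)"
  by (simp add: laurent_at_infinity_def)

lemma laurent_at_infinity_add:
  assumes "laurent_at_infinity R A v" "laurent_at_infinity R B w"
  shows "laurent_at_infinity R (A + B) (\<lambda>lam. v lam + w lam)"
  using assms
  by (auto simp: laurent_at_infinity_def eval_fps_add
      intro!: order_less_le_trans[OF _ fps_conv_radius_add])

lemma laurent_at_infinity_diff: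
  assumes "laurent_at_infinity R A v" "laurent_at_infinity R B w"
  shows "laurent_at_infinity R (A - B) (\<lambda>lam. v lam - w lam)"
  using assms
  by (auto simp: laurent_at_infinity_def eval_fps_diff
      intro!: order_less_le_trans[OF _ fps_conv_radius_diff])

lemma laurent_at_infinity_mult:
  assumes "laurent_at_infinity R A v" "laurent_at_infinity R B w"
  shows "laurent_at_infinity R (A * B) (\<lambda>lam. v lam * w lam)"
  using assms
  by (auto simp: laurent_at_infinity_def eval_fps_mult
      intro!: order_less_le_trans[OF _ fps_conv_radius_mult])

lemma laurent_at_infinity_sum:
  "(\<And>i. i \<in> S \<Longrightarrow> laurent_at_infinity R (A i) (w i)) \<Longrightarrow>
    laurent_at_infinity R (\<Sum>i\<in>S. A i) (\<lambda>lam. \<Sum>i\<in>S. w i lam)"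
  by (induction S rule: infinite_finite_induct)
    (simp_all add: laurent_at_infinity_add laurent_at_infinity_const[of R 0, simplified])

lemmas laurent_at_infinity_intros = laurent_at_infinity_const laurent_at_infinity_add
  laurent_at_infinity_diff laurent_at_infinity_mult laurent_at_infinity_sum

lemma laurent_at_infinity_trace_mult:
  fixes A B :: "complex fps^'n^'n"
  assumes "\<And>i j. laurent_at_infinity R (A $ i $ j) (\<lambda>lam. M lam $ i $ j)"
    and "\<And>i j. laurent_at_infinity R (B $ i $ j) (\<lambda>lam. N lam $ i $ j)"
  shows "laurent_at_infinity R (trace (A ** B)) (\<lambda>lam. trace (M lam ** N lam))"
  unfolding trace_def matrix_matrix_mult_def vec_lambda_beta
  by (intro laurent_at_infinity_sum laurent_at_infinity_mult assms)

lemma laurent_at_infinity_char_coeff: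
  assumes "\<And>i j. laurent_at_infinity R (A $ i $ j) (\<lambda>lam. M lam $ i $ j)"
  shows "laurent_at_infinity R (char_coeff k A) (\<lambda>lam. char_coeff k (M lam))"
  unfolding char_coeff_def trace_def det_3
  by (cases "k = 1"; cases "k = 2") (simp_all add: assms laurent_at_infinity_intros)

lemma laurent_at_infinity_char_coeff_grad:
  assumes "\<And>i j. laurent_at_infinity R (A $ i $ j) (\<lambda>lam. M lam $ i $ j)"
  shows "laurent_at_infinity R (char_coeff_grad k A $ i $ j)
    (\<lambda>lam. char_coeff_grad k (M lam) $ i $ j)"
proof -
  have mat: "laurent_at_infinity R (mat a $ i $ j) (\<lambda>lam. mat (w lam) $ i $ j)"
    if "laurent_at_infinity R a w" for a w and i j :: 3
    using that laurent_at_infinity_const[of R 0] by (cases "i = j") (simp_all add: mat_def)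
  have trace: "laurent_at_infinity R (trace A) (\<lambda>lam. trace (M lam))"
    unfolding trace_def by (intro laurent_at_infinity_sum assms)
  have square: "laurent_at_infinity R ((A ** A) $ i $ j) (\<lambda>lam. (M lam ** M lam) $ i $ j)" for i j
    unfolding matrix_matrix_mult_def vec_lambda_beta by (intro laurent_at_infinity_intros assms)
  show ?thesis
    using mat[OF laurent_at_infinity_const[of R 1]]
    unfolding char_coeff_grad_def
    by (cases "k = 1"; cases "k = 2")
      (simp_all add: mat_mult_nth assms mat trace square laurent_at_infinity_char_coeff
        laurent_at_infinity_intros)
qed

lemma laurent_at_infinity_unique:
  assumes A: "laurent_at_infinity R A v" and B: "laurent_at_infinity R' B w"
    and eq: "\<And>lam. max R R' < cmod lam \<Longrightarrow> v lam = w lam"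
  shows "A = B"
proof -
  obtain r where r: "r > 0" "max R R' < r"
    using gt_ex[of "max 0 (max R R')"] by auto
  have radius: "fps_conv_radius C \<ge> 1 / r" if "laurent_at_infinity Q C u" "Q < r" for Q C u
    using that r(1) unfolding laurent_at_infinity_def
    by (auto dest!: spec[of _ "of_real r"] simp: norm_divide)
  have pos: "fps_conv_radius (fps_X * A) > 0" "fps_conv_radius (fps_X * B) > 0"
    using radius[OF A] radius[OF B] r
    by (auto intro!: order_less_le_trans[OF _ fps_conv_radius_mult]
        elim!: order_less_le_trans[rotated])
  have large: "r < cmod (1 / x)" if "cmod x < 1 / r" "x \<noteq> 0" for x :: complex
    using that r(1) by (simp add: norm_divide field_simps)
  have eval: "eval_fps (fps_X * C) x = x * u (1 / x)"
    if C: "laurent_at_infinity Q C u" "Q < r" and x: "cmod x < 1 / r" "x \<noteq> 0" for Q C u x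
  proof -
    have "Q < cmod (1 / x)"
      using C(2) large[OF x] by linarith
    then show ?thesis
      using C(1) x by (auto simp: laurent_at_infinity_def eval_fps_mult dest!: spec[of _ "1 / x"])
  qed
  have "eval_fps (fps_X * A) x = eval_fps (fps_X * B) x" if x: "cmod x < 1 / r" for x
  proof (cases "x = 0")
    case False
    have "max R R' < cmod (1 / x)"
      using r(2) large[OF x False] by linarith
    then show ?thesis
      using eval[OF A _ x False] eval[OF B _ x False] r(2) eq by simp
  qed (simp add: eval_fps_at_0)
  then have "\<forall>\<^sub>F x in nhds 0. eval_fps (fps_X * A) x = eval_fps (fps_X * B) x"
    using r(1) by (auto simp: eventually_nhds_metric intro!: exI[of _ "1 / r"])
  with pos have "fps_X * A = fps_X * B" by (rule eval_fps_eqD)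
  then show ?thesis by simp
qed

lemma laurent_at_infinity_cnj:
  assumes "R \<ge> 0" "laurent_at_infinity R A w"
  shows "laurent_at_infinity R (Abs_fps (\<lambda>n. cnj (fps_nth A n))) (\<lambda>lam. cnj (w (cnj lam)))"
proof -
  have "(\<lambda>n. cnj (fps_nth A n) / lam ^ n) sums cnj (w (cnj lam))" if "R < cmod lam" for lam
  proof -
    have "(\<lambda>n. fps_nth A n / cnj lam ^ n) sums w (cnj lam)"
      using assms that by (simp add: laurent_at_infinity_iff_sums)
    then show ?thesis
      by (subst (asm) sums_cnj[symmetric]) simp
  qed
  with \<open>R \<ge> 0\<close> show ?thesis by (simp add: laurent_at_infinity_iff_sums)
qed

definition resolvent_fps :: "complex \<Rightarrow> complex fps" where
  "resolvent_fps l = fps_X * Abs_fps (\<lambda>n. l ^ n)"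

lemma fps_nth_resolvent:
  shows "fps_nth (resolvent_fps l) 0 = 0"
    and "fps_nth (resolvent_fps l) (Suc n) = l ^ n"
  by (simp_all add: resolvent_fps_def)

lemma laurent_at_infinity_resolvent:
  "laurent_at_infinity (cmod l) (resolvent_fps l) (\<lambda>lam. 1 / (lam - l))"
  unfolding laurent_at_infinity_iff_sums[OF norm_ge_zero]
proof (intro allI impI)
  fix lam assume lam: "cmod l < cmod lam"
  then have "lam \<noteq> 0" "lam \<noteq> l" by auto
  have "(\<lambda>n. (l / lam) ^ n) sums (1 / (1 - l / lam))"
    using lam by (intro geometric_sums) (simp add: norm_divide divide_less_eq)
  from sums_mult[OF this, of "1 / lam"] have "(\<lambda>n. l ^ n / lam ^ Suc n) sums (1 / (lam - l))"
    using \<open>lam \<noteq> 0\<close> \<open>lam \<noteq> l\<close> by (simp add: field_simps)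
  then show "(\<lambda>n. fps_nth (resolvent_fps l) n / lam ^ n) sums (1 / (lam - l))"
    using sums_Suc_iff[of "\<lambda>n. fps_nth (resolvent_fps l) n / lam ^ n"]
    by (simp add: fps_nth_resolvent)
qed

subsection \<open>The integrals of motion\<close>

definition Lax_fps :: "real^'n::finite \<Rightarrow> complex^'n^3 \<Rightarrow> (complex fps)^3^3" where
  "Lax_fps Lam z = (\<chi> i j. fps_const (Cmat $ i $ j) +
    (\<Sum>a\<in>UNIV. resolvent_fps (of_real (Lam$a)) * fps_const (z$i$a * cnj (z$j$a))))"

definition power_moment :: "real^'n::finite \<Rightarrow> nat \<Rightarrow> 3 \<Rightarrow> 3 \<Rightarrow> complex^'n^3 \<Rightarrow> complex" where
  "power_moment Lam m = moment (\<lambda>a. of_real (Lam$a) ^ m)"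

lemma polynomial_function_power_moment [simp]: "polynomial_function (power_moment Lam m i j)"
  by (simp add: power_moment_def)

lemma fps_nth_Lax_fps:
  shows "fps_nth (Lax_fps Lam z $ i $ j) 0 = Cmat $ i $ j"
    and "fps_nth (Lax_fps Lam z $ i $ j) (Suc m) = power_moment Lam m i j z"
  by (simp_all add: Lax_fps_def fps_sum_nth fps_nth_resolvent power_moment_def moment_def)

lemma polynomial_function_Lax_fps: "polynomial_function (\<lambda>z. fps_nth (Lax_fps Lam z $ i $ j) n)"
  by (cases n) (simp_all add: fps_nth_Lax_fps)

lemma abs_le_Rmax: "\<bar>Lam $ a\<bar> \<le> Rmax Lam"
  unfolding Rmax_def by (intro Max_ge) auto

lemma Rmax_nonneg: "0 \<le> Rmax Lam"
  using abs_le_Rmax[of Lam undefined] by linarith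

lemma laurent_at_infinity_resolvent_Lam:
  "laurent_at_infinity (Rmax Lam) (resolvent_fps (of_real (Lam$a)))
    (\<lambda>lam. 1 / (lam - of_real (Lam$a)))"
  by (rule laurent_at_infinity_mono[OF laurent_at_infinity_resolvent]) (simp add: abs_le_Rmax)

lemma laurent_at_infinity_Lax:
  "laurent_at_infinity (Rmax Lam) (Lax_fps Lam z $ i $ j) (\<lambda>lam. Lax Lam lam z $ i $ j)"
  unfolding Lax_nth Lax_fps_def moment_def vec_lambda_beta
  by (intro laurent_at_infinity_intros laurent_at_infinity_resolvent_Lam)

lemma Ecoef_eq: "Ecoef Lam k m = (\<lambda>z. fps_nth (char_coeff k (Lax_fps Lam z)) (Suc m))"
proof
  fix z
  let ?C = "char_coeff k (Lax_fps Lam z)"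
  have pk: "laurent_at_infinity (Rmax Lam) ?C (\<lambda>lam. pk Lam k lam z)"
    unfolding pk_eq_char_coeff by (intro laurent_at_infinity_char_coeff laurent_at_infinity_Lax)
  have "(THE c. \<forall>lam. Rmax Lam < cmod lam \<longrightarrow> (\<lambda>n. c n / lam ^ n) sums pk Lam k lam z) = fps_nth ?C"
  proof (rule the_equality)
    show "\<forall>lam. Rmax Lam < cmod lam \<longrightarrow> (\<lambda>n. fps_nth ?C n / lam ^ n) sums pk Lam k lam z"
      using pk by (simp only: laurent_at_infinity_iff_sums[OF Rmax_nonneg])
    fix c assume "\<forall>lam. Rmax Lam < cmod lam \<longrightarrow> (\<lambda>n. c n / lam ^ n) sums pk Lam k lam z"
    then have "laurent_at_infinity (Rmax Lam) (Abs_fps c) (\<lambda>lam. pk Lam k lam z)"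
      by (simp add: laurent_at_infinity_iff_sums[OF Rmax_nonneg])
    from laurent_at_infinity_unique[OF this pk] show "c = fps_nth ?C" by (auto simp: fps_eq_iff)
  qed
  then show "Ecoef Lam k m z = fps_nth ?C (Suc m)" by (simp add: Ecoef_def)
qed

lemma polynomial_function_Ecoef [simp]:
  fixes Lam :: "real^'n::finite"
  shows "polynomial_function (Ecoef Lam k m)"
proof -
  interpret coefficientwise: function_algebra
    "\<lambda>A :: complex^'n^3 \<Rightarrow> complex fps. \<forall>n. polynomial_function (\<lambda>z. fps_nth (A z) n)"
    by (rule polynomial.function_algebra_fps)
  show ?thesis
    unfolding Ecoef_eq
    using coefficientwise.closed_char_coeff[of "Lax_fps Lam" k] polynomial_function_Lax_fps by blast
qed

text \<open>All the expansion coefficients are combinations of the same finitely many products of phase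
  variables, so no derivation is interchanged with an infinite series.\<close>
lemma laurent_at_infinity_derivation_Lax:
  fixes Lam :: "real^'n::finite" and D :: "(complex^'n^3 \<Rightarrow> complex) \<Rightarrow> complex"
  assumes "point_derivation (\<lambda>f. f differentiable (at z)) z D"
  shows "laurent_at_infinity (Rmax Lam)
    (Abs_fps (\<lambda>n. D (\<lambda>z. fps_nth (Lax_fps Lam z $ i $ j) n))) (\<lambda>lam. D (\<lambda>z. Lax Lam lam z $ i $ j))"
proof -
  interpret D: point_derivation "\<lambda>f. f differentiable (at z)" z D by (fact assms)
  define q where "q a z = z$i$a * cnj (z$j$a)" for a and z :: "complex^'n^3"
  have [simp]: "polynomial_function (q a)" for a by (simp add: q_def[abs_def])
  have D_moment: "D (moment f i j) = (\<Sum>a\<in>UNIV. f a * D (q a))" for f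
    by (simp add: moment_def[abs_def] D.rules q_def[symmetric])
  have "D (\<lambda>z. fps_nth (Lax_fps Lam z $ i $ j) n) =
      fps_nth (\<Sum>a\<in>UNIV. resolvent_fps (of_real (Lam$a)) * fps_const (D (q a))) n" for n
    by (cases n)
      (simp_all add: fps_nth_Lax_fps fps_sum_nth fps_nth_resolvent D.const D_moment
        power_moment_def)
  then have "Abs_fps (\<lambda>n. D (\<lambda>z. fps_nth (Lax_fps Lam z $ i $ j) n)) =
      (\<Sum>a\<in>UNIV. resolvent_fps (of_real (Lam$a)) * fps_const (D (q a)))"
    by (simp add: fps_eq_iff)
  moreover have "D (\<lambda>z. Lax Lam lam z $ i $ j) =
      (\<Sum>a\<in>UNIV. 1 / (lam - of_real (Lam$a)) * D (q a))" for lam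
    by (simp add: Lax_nth D.rules D_moment)
  ultimately show ?thesis
    by (simp only:) (intro laurent_at_infinity_intros laurent_at_infinity_resolvent_Lam)
qed

lemma laurent_at_infinity_derivation_char_coeff:
  fixes Lam :: "real^'n::finite" and D :: "(complex^'n^3 \<Rightarrow> complex) \<Rightarrow> complex"
  assumes D: "point_derivation (\<lambda>f. f differentiable (at z)) z D"
  shows "laurent_at_infinity (Rmax Lam)
    (Abs_fps (\<lambda>n. D (\<lambda>z. fps_nth (char_coeff k (Lax_fps Lam z)) n)))
    (\<lambda>lam. D (\<lambda>z. char_coeff k (Lax Lam lam z)))"
proof -
  interpret D: point_derivation "\<lambda>f. f differentiable (at z)" z D by (fact D)
  interpret D_fps: point_derivation
    "\<lambda>A. \<forall>n. (\<lambda>x. fps_nth (A x) n) differentiable (at z)" z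
    "\<lambda>A. Abs_fps (\<lambda>n. D (\<lambda>x. fps_nth (A x) n))"
    by (rule D.point_derivation_fps)
  let ?D_Lax_fps = "\<chi> i j. Abs_fps (\<lambda>n. D (\<lambda>z. fps_nth (Lax_fps Lam z $ i $ j) n))"
  have "laurent_at_infinity (Rmax Lam)
    (trace (char_coeff_grad k (Lax_fps Lam z) ** ?D_Lax_fps))
    (\<lambda>lam. trace (char_coeff_grad k (Lax Lam lam z) ** (\<chi> i j. D (\<lambda>z. Lax Lam lam z $ i $ j))))"
    using laurent_at_infinity_derivation_Lax[OF D]
    by (intro laurent_at_infinity_trace_mult laurent_at_infinity_char_coeff_grad
        laurent_at_infinity_Lax) simp
  moreover have "D (\<lambda>z. char_coeff k (Lax Lam lam z)) =
      trace (char_coeff_grad k (Lax Lam lam z) ** (\<chi> i j. D (\<lambda>z. Lax Lam lam z $ i $ j)))" for lam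
    by (intro D.char_coeff) simp
  moreover have "Abs_fps (\<lambda>n. D (\<lambda>z. fps_nth (char_coeff k (Lax_fps Lam z)) n)) =
      trace (char_coeff_grad k (Lax_fps Lam z) ** ?D_Lax_fps)"
    by (intro D_fps.char_coeff) (simp add: polynomial_function_Lax_fps)
  ultimately show ?thesis by (simp only:)
qed

lemma Rmax_less_imp_not_pole:
  assumes "Rmax Lam < cmod lam"
  shows "lam \<notin> range (\<lambda>a. of_real (Lam$a))"
proof
  assume "lam \<in> range (\<lambda>a. of_real (Lam$a))"
  then obtain a where "lam = of_real (Lam$a)" by blast
  with assms abs_le_Rmax[of Lam a] show False by simp
qed

lemma PB_Ecoef: "PB (Ecoef Lam k m) (Ecoef Lam k' m') z = 0"
proof -
  define C where "C k n z = fps_nth (char_coeff k (Lax_fps Lam z)) n" for k n z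
  define p where "p k lam z = char_coeff k (Lax Lam lam z)" for k lam z
  have zero: "laurent_at_infinity R 0 (\<lambda>lam. 0)" for R
    using laurent_at_infinity_const[of R 0] by simp
  have vanish: "PB (C k n) (p k' mu) z = 0" if mu: "Rmax Lam < cmod mu" for n mu
  proof -
    have "Abs_fps (\<lambda>n. PB (C k n) (p k' mu) z) = 0"
    proof (rule laurent_at_infinity_unique[OF _ zero])
      show "laurent_at_infinity (Rmax Lam) (Abs_fps (\<lambda>n. PB (C k n) (p k' mu) z))
          (\<lambda>lam. PB (p k lam) (p k' mu) z)"
        unfolding C_def[abs_def] p_def[abs_def]
        by (rule laurent_at_infinity_derivation_char_coeff[OF PB_left.point_derivation_axioms])
      show "PB (p k lam) (p k' mu) z = 0" if "max (Rmax Lam) (cmod mu) < cmod lam" for lam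
        unfolding p_def[abs_def]
        using that mu by (intro PB_char_coeff_Lax Rmax_less_imp_not_pole) auto
    qed
    then show ?thesis by (simp add: fps_eq_iff)
  qed
  have expansion: "laurent_at_infinity (Rmax Lam) (Abs_fps (\<lambda>m. PB (C k n) (C k' m) z))
      (\<lambda>mu. PB (C k n) (p k' mu) z)" for n
    unfolding C_def[abs_def] p_def[abs_def]
    by (rule laurent_at_infinity_derivation_char_coeff[OF PB_right.point_derivation_axioms])
  have "Abs_fps (\<lambda>m. PB (C k n) (C k' m) z) = 0" for n
    by (rule laurent_at_infinity_unique[OF expansion zero]) (auto intro: vanish)
  then have "PB (C k (Suc m)) (C k' (Suc m')) z = 0"
    by (simp add: fps_eq_iff)
  then show ?thesis
    by (simp only: Ecoef_eq C_def[abs_def])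
qed

lemma ip_eq_power_moment: "ip Lam m (z$i) (z$j) = power_moment Lam m j i z"
  unfolding ip_def power_moment_def moment_def by (intro sum.cong refl) simp

lemma cnj_power_moment: "cnj (power_moment Lam m i j z) = power_moment Lam m j i z"
  by (simp add: power_moment_def moment_def mult.commute)

lemma sqabs_power_moment:
  "sqabs (power_moment Lam m i j z) = power_moment Lam m i j z * power_moment Lam m j i z"
  unfolding sqabs_def by (simp only: complex_norm_square cnj_power_moment)

lemma Re_power_moment_mult:
  "4 * complex_of_real (Re (power_moment Lam m i j z * power_moment Lam m' k l z)) =
    2 * (power_moment Lam m i j z * power_moment Lam m' k l z
      + power_moment Lam m j i z * power_moment Lam m' l k z)"
  using complex_add_cnj[of "power_moment Lam m i j z * power_moment Lam m' k l z"]
  by (simp only: complex_cnj_mult cnj_power_moment) simp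

lemma Ecoef_expansions:
  fixes Lam :: "real^'n::finite"
  defines "G \<equiv> power_moment Lam"
  defines "M \<equiv> \<lambda>m n i j z. G m i i z * G n j j z - G m i j z * G n j i z"
  shows "Ecoef Lam 1 m z = G m 1 1 z + G m 2 2 z + G m 3 3 z"
    and "Ecoef Lam 2 0 z = G 0 2 2 z - G 0 1 1 z"
    and "Ecoef Lam 2 1 z = G 1 2 2 z - G 1 1 1 z + M 0 0 1 2 z + M 0 0 1 3 z + M 0 0 2 3 z"
    and "Ecoef Lam 2 2 z = G 2 2 2 z - G 2 1 1 z + M 0 1 1 2 z + M 0 1 1 3 z + M 0 1 2 3 z
      + M 1 0 1 2 z + M 1 0 1 3 z + M 1 0 2 3 z"
    and "Ecoef Lam 3 0 z = - G 0 3 3 z"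
    and "Ecoef Lam 3 1 z = - G 1 3 3 z + M 0 0 2 3 z - M 0 0 1 3 z"
  by (simp_all add: Ecoef_eq char_coeff_def trace_def det_3 sum_3 fps_mult_nth eval_nat_numeral
      fps_nth_Lax_fps Cmat_def G_def M_def algebra_simps)

lemma Hamiltonians_power_moment:
  fixes Lam :: "real^'n::finite"
  defines "G \<equiv> power_moment Lam"
  shows "Hx Lam = (\<lambda>z. - G 1 1 1 z - G 1 2 2 z - G 0 3 1 z * G 0 1 3 z + G 0 3 2 z * G 0 2 3 z)"
    and "Hy Lam = (\<lambda>z. - G 1 1 1 z + G 1 2 2 z - G 0 3 1 z * G 0 1 3 z - G 0 3 2 z * G 0 2 3 z
      - G 0 2 1 z * G 0 1 2 z)"
    and "Ht Lam = (\<lambda>z. 2 * G 2 1 1 z - 2 * G 2 2 2 z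
      + 2 * (G 0 3 1 z * G 1 1 3 z + G 0 1 3 z * G 1 3 1 z)
      + 2 * (G 0 3 2 z * G 1 2 3 z + G 0 2 3 z * G 1 3 2 z)
      + 2 * (G 0 2 1 z * G 1 1 2 z + G 0 1 2 z * G 1 2 1 z)
      + 2 * (G 0 3 3 z - G 0 1 1 z) * (G 0 3 1 z * G 0 1 3 z)
      - 2 * (G 0 3 3 z - G 0 2 2 z) * (G 0 3 2 z * G 0 2 3 z)
      - (G 0 1 1 z - G 0 2 2 z) * (G 0 2 1 z * G 0 1 2 z))"
  unfolding Hx_def Hy_def Ht_def Omega_def ip_eq_power_moment sqabs_power_moment
    Re_power_moment_mult G_def
  by (rule refl)+

lemma Omega_Ecoef:
  shows "Omega Lam z 1 = 1 / 2 * (Ecoef Lam 1 0 z + Ecoef Lam 3 0 z - Ecoef Lam 2 0 z)"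
    and "Omega Lam z 2 = 1 / 2 * (Ecoef Lam 1 0 z + Ecoef Lam 3 0 z + Ecoef Lam 2 0 z)"
    and "Omega Lam z 3 = - Ecoef Lam 3 0 z"
  unfolding Omega_def ip_eq_power_moment Ecoef_expansions by simp_all

lemma Hamiltonians_Ecoef:
  fixes Lam :: "real^'n::finite"
  defines "E \<equiv> Ecoef Lam"
  defines "W \<equiv> \<lambda>j z. Omega Lam z j"
  defines "S \<equiv> \<lambda>z. W 1 z * W 2 z + W 1 z * W 3 z + W 2 z * W 3 z"
  shows "Hx Lam = (\<lambda>z. - E 1 1 z - E 3 1 z - E 2 0 z * E 3 0 z)"
    and "Hy Lam = (\<lambda>z. E 2 1 z - S z)"
    and "Ht Lam = (\<lambda>z. - 2 * E 2 2 z + (W 2 z - W 1 z) * (S z - E 2 1 z)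
        + (W 1 z + W 2 z - 2 * W 3 z) * (W 2 z * W 3 z - W 1 z * W 3 z - E 3 1 z)
        + (E 1 0 z - E 3 0 z) * E 1 1 z)"
proof -
  show "Hx Lam = (\<lambda>z. - E 1 1 z - E 3 1 z - E 2 0 z * E 3 0 z)"
    unfolding Hamiltonians_power_moment E_def Ecoef_expansions
    by (rule ext) (simp add: algebra_simps)
  show "Hy Lam = (\<lambda>z. E 2 1 z - S z)"
    unfolding Hamiltonians_power_moment S_def W_def E_def Omega_def ip_eq_power_moment
      Ecoef_expansions
    by (rule ext) (simp add: algebra_simps)
  show "Ht Lam = (\<lambda>z. - 2 * E 2 2 z + (W 2 z - W 1 z) * (S z - E 2 1 z)
        + (W 1 z + W 2 z - 2 * W 3 z) * (W 2 z * W 3 z - W 1 z * W 3 z - E 3 1 z)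
        + (E 1 0 z - E 3 0 z) * E 1 1 z)"
    unfolding Hamiltonians_power_moment S_def W_def E_def Omega_def ip_eq_power_moment
      Ecoef_expansions
    by (rule ext) (simp add: algebra_simps)
qed

lemma polynomial_function_Omega [simp]: "polynomial_function (\<lambda>z. Omega Lam z j)"
  by (simp add: Omega_def ip_eq_power_moment)

lemma PB_Omega_eq_0:
  assumes "\<And>k m. PB h (Ecoef Lam k m) z = 0"
  shows "PB h (\<lambda>z. Omega Lam z j) z = 0"
proof -
  have half: "PB h (\<lambda>z. 1 / 2 * f z) z = 0" if "polynomial_function f" "PB h f z = 0" for f
    by (subst PB_right.mult) (simp_all add: that PB_right.const)
  have "PB h (\<lambda>z. Omega Lam z 1) z = 0" "PB h (\<lambda>z. Omega Lam z 2) z = 0"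
    unfolding Omega_Ecoef by (rule half; simp add: PB_right.rules assms)+
  moreover have "PB h (\<lambda>z. Omega Lam z 3) z = 0"
    by (simp add: Omega_Ecoef PB_right.rules assms)
  ultimately show ?thesis
    using exhaust_3[of j] by auto
qed

lemma PB_Hamiltonians_eq_0:
  assumes "\<And>k m. PB h (Ecoef Lam k m) z = 0"
  shows "PB h (Hx Lam) z = 0" "PB h (Hy Lam) z = 0" "PB h (Ht Lam) z = 0"
  unfolding Hamiltonians_Ecoef by (simp_all add: PB_right.rules PB_Omega_eq_0 assms)

lemma PB_Hamiltonians_Ecoef:
  shows "PB (Hx Lam) (Ecoef Lam k m) z = 0"
    and "PB (Hy Lam) (Ecoef Lam k m) z = 0"
    and "PB (Ht Lam) (Ecoef Lam k m) z = 0"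
  unfolding PB_antisym[of _ "Ecoef Lam k m"] by (simp_all add: PB_Hamiltonians_eq_0 PB_Ecoef)

subsection \<open>Determinants and ranks\<close>

lemma det_nonzero_if_kernel_trivial:
  fixes A :: "'a::field^'n^'n"
  assumes "\<And>x. A *v x = 0 \<Longrightarrow> x = 0"
  shows "det A \<noteq> 0"
  using assms matrix_left_invertible_ker[of A]
  by (simp add: invertible_det_nz[symmetric] invertible_left_inverse)

lemma det_Vandermonde_nonzero:
  fixes x :: "'n::finite \<Rightarrow> 'a::field" and e :: "'n \<Rightarrow> nat"
  assumes "inj x" and e: "bij_betw e UNIV {..<CARD('n)}"
  shows "det (\<chi> a b. x b ^ e a) \<noteq> 0"
proof -
  have "y = 0" if "(\<chi> b a. x b ^ e a) *v y = 0" for y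
  proof -
    define p where "p = (\<Sum>a\<in>UNIV. monom (y $ a) (e a))"
    have "poly p (x b) = ((\<chi> b a. x b ^ e a) *v y) $ b" for b
      by (simp add: p_def poly_sum poly_monom matrix_vector_mult_def mult.commute)
    then have roots: "range x \<subseteq> {t. poly p t = 0}"
      using that by auto
    have "e a \<le> CARD('n) - 1" for a
      using bij_betwE[OF e, rule_format, of a] by auto
    then have "degree p \<le> CARD('n) - 1"
      unfolding p_def by (intro degree_sum_le) (auto intro: degree_monom_le[THEN order_trans])
    moreover have "p = 0 \<or> CARD('n) \<le> degree p"
      using card_mono[OF poly_roots_finite roots] card_poly_roots_bound[of p] card_image[OF \<open>inj x\<close>]
      by (metis order_trans)
    ultimately have "p = 0"
      using zero_less_card_finite[where 'a='n] by linarith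
    moreover have "coeff p (e a) = y $ a" for a
      using e by (simp add: p_def coeff_sum bij_betw_def inj_eq)
    ultimately show "y = 0"
      by (simp add: vec_eq_iff)
  qed
  then have "det (\<chi> b a. x b ^ e a) \<noteq> 0"
    by (rule det_nonzero_if_kernel_trivial)
  moreover have "transpose (\<chi> b a. x b ^ e a) = (\<chi> a b. x b ^ e a)"
    by (simp add: transpose_def)
  ultimately show ?thesis
    by (metis det_transpose)
qed

definition kronecker :: "'a::semiring_1^'m^'m \<Rightarrow> 'a^'n^'n \<Rightarrow> 'a^('m \<times> 'n)^('m \<times> 'n)" where
  "kronecker A B = (\<chi> p q. A $ fst p $ fst q * B $ snd p $ snd q)"

lemma kronecker_mult:
  fixes A C :: "'a::comm_semiring_1^'m::finite^'m" and B D :: "'a^'n::finite^'n"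
  shows "kronecker A B ** kronecker C D = kronecker (A ** C) (B ** D)"
  by (simp add: vec_eq_iff kronecker_def matrix_matrix_mult_def sum_product sum.cartesian_product
      case_prod_beta' mult_ac flip: UNIV_Times_UNIV)

lemma kronecker_mat_1: "kronecker (mat 1) (mat 1) = mat 1"
  by (simp add: vec_eq_iff kronecker_def mat_def prod_eq_iff)

lemma det_kronecker_nonzero:
  fixes A :: "'a::field^'m::finite^'m" and B :: "'a^'n::finite^'n"
  assumes "det A \<noteq> 0" "det B \<noteq> 0"
  shows "det (kronecker A B) \<noteq> 0"
proof -
  obtain A' B' where "A' ** A = mat 1" "B' ** B = mat 1"
    using assms by (auto simp: invertible_det_nz[symmetric] invertible_left_inverse)
  then have "kronecker A' B' ** kronecker A B = mat 1"
    by (simp add: kronecker_mult kronecker_mat_1)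
  then show ?thesis
    by (metis invertible_det_nz invertible_left_inverse)
qed

lemma dim_range_le_if_real_valued:
  fixes G :: "'a::real_vector \<Rightarrow> complex^'p::finite"
  assumes "\<And>v p. Im (G v $ p) = 0"
  shows "dim (range G) \<le> CARD('p)"
proof -
  define r :: "real^'p \<Rightarrow> complex^'p" where "r x = (\<chi> p. of_real (x $ p))" for x
  have "linear r"
    by (rule linearI) (simp_all add: r_def vec_eq_iff scaleR_conv_of_real[where 'a=complex])
  have "G v = r (\<chi> p. Re (G v $ p))" for v
    using assms by (simp add: r_def vec_eq_iff complex_eq_iff)
  then have "dim (range G) \<le> dim (range r)"
    by (intro dim_subset) blast
  also have "\<dots> \<le> dim (UNIV :: (real^'p) set)"
    using \<open>linear r\<close> by (rule dim_image_le)
  finally show ?thesis by simp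
qed

lemma dim_range_ge_if_det_nonzero:
  fixes G :: "'a::real_vector \<Rightarrow> complex^'p::finite"
  assumes "linear G" and det: "det (\<chi> p q. G (w q) $ p) \<noteq> 0"
  shows "CARD('p) \<le> dim (range G)"
proof -
  define T :: "real^'p \<Rightarrow> complex^'p" where "T x = G (\<Sum>q\<in>UNIV. x $ q *\<^sub>R w q)" for x
  have T_sum: "T x = (\<Sum>q\<in>UNIV. x $ q *\<^sub>R G (w q))" for x
    by (simp add: T_def linear_sum[OF \<open>linear G\<close>] linear_cmul[OF \<open>linear G\<close>])
  have "linear T"
    by (rule linearI) (simp_all add: T_sum scaleR_add_left sum.distrib scaleR_sum_right)
  have "x = 0" if "T x = 0" for x
  proof -
    have "(\<chi> p q. G (w q) $ p) *v (\<chi> q. of_real (x $ q)) = T x"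
      by (simp add: T_sum vec_eq_iff matrix_vector_mult_def mult.commute
          scaleR_conv_of_real[where 'a=complex])
    moreover have "\<exists>B. B ** (\<chi> p q. G (w q) $ p) = mat 1"
      using det by (simp add: invertible_det_nz[symmetric] invertible_left_inverse)
    ultimately have "(\<chi> q. complex_of_real (x $ q)) = 0"
      using that unfolding matrix_left_invertible_ker by simp
    then show ?thesis by (simp add: vec_eq_iff)
  qed
  then have "inj T"
    using \<open>linear T\<close> by (simp add: linear_injective_0)
  then have "dim (range T) = CARD('p)"
    using dim_image_eq[OF \<open>linear T\<close>, of UNIV] by (simp add: inj_on_subset)
  moreover have "dim (range T) \<le> dim (range G)"
    by (intro dim_subset) (auto simp: T_def)
  ultimately show ?thesis by simp
qed

subsection \<open>Functional independence\<close>

definition Jacobian :: "real^'n::finite \<Rightarrow> complex^'n^3 \<Rightarrow> complex^(3 \<times> 'n)^(3 \<times> 'n)" where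
  "Jacobian Lam z = (\<chi> p q. dd (Ecoef Lam (knum (fst p)) (idx (snd p))) z (re_dir (fst q) (snd q)))"

lemma polynomial_function_det_Jacobian: "polynomial_function (\<lambda>z. det (Jacobian Lam z))"
  by (intro polynomial.closed_det) (simp add: Jacobian_def polynomial_function_dd)

lemma dd_Ecoef:
  fixes Lam :: "real^'n::finite"
  shows "dd (Ecoef Lam k m) z v = fps_nth (trace (char_coeff_grad k (Lax_fps Lam z) **
    (\<chi> i j. Abs_fps (\<lambda>n. dd (\<lambda>z. fps_nth (Lax_fps Lam z $ i $ j) n) z v)))) (Suc m)"
proof -
  interpret dd_fps: point_derivation
    "\<lambda>A :: complex^'n^3 \<Rightarrow> complex fps. \<forall>n. (\<lambda>x. fps_nth (A x) n) differentiable (at z)" z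
    "\<lambda>A. Abs_fps (\<lambda>n. dd (\<lambda>x. fps_nth (A x) n) z v)"
    by (rule dd.point_derivation_fps)
  have "Abs_fps (\<lambda>n. dd (\<lambda>z. fps_nth (char_coeff k (Lax_fps Lam z)) n) z v) =
      trace (char_coeff_grad k (Lax_fps Lam z) **
        (\<chi> i j. Abs_fps (\<lambda>n. dd (\<lambda>z. fps_nth (Lax_fps Lam z $ i $ j) n) z v)))"
    by (rule dd_fps.char_coeff) (simp add: polynomial_function_Lax_fps)
  from arg_cong[OF this, of "\<lambda>A. fps_nth A (Suc m)"] show ?thesis
    by (simp only: Ecoef_eq fps_nth_Abs_fps)
qed

definition constant_point :: "real \<Rightarrow> complex^'n::finite^3" where
  "constant_point t = (\<chi> j a. of_real t)"

definition reduced_Jacobian :: "real^'n::finite \<Rightarrow> complex^'n^3 \<Rightarrow> complex^(3 \<times> 'n)^(3 \<times> 'n)" where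
  "reduced_Jacobian Lam z = (\<chi> p q.
    let G = char_coeff_grad (knum (fst p)) (Lax_fps Lam z);
      R = resolvent_fps (of_real (Lam $ snd q))
    in fps_nth (R * (\<Sum>i\<in>UNIV. G $ i $ fst q + G $ fst q $ i)) (Suc (idx (snd p))))"

lemma dd_Lax_fps_constant_point:
  "Abs_fps (\<lambda>n. dd (\<lambda>z. fps_nth (Lax_fps Lam z $ i $ j) n) (constant_point t) (re_dir k b)) =
    resolvent_fps (of_real (Lam$b)) *
    fps_const (of_real t * ((if i = k then 1 else 0) + (if j = k then 1 else 0)))"
  (is "Abs_fps (\<lambda>n. dd (?L n) _ _) = _ * fps_const ?c")
proof (rule fps_ext)
  fix n
  show "fps_nth (Abs_fps (\<lambda>n. dd (?L n) (constant_point t) (re_dir k b))) n =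
      fps_nth (resolvent_fps (of_real (Lam$b)) * fps_const ?c) n"
  proof (cases n)
    case (Suc m)
    have "dd (power_moment Lam m i j) (constant_point t) (re_dir k b) =
        (\<Sum>a\<in>UNIV. if a = b then of_real (Lam$a) ^ m * ?c else 0)"
      unfolding power_moment_def dd_moment
      by (intro sum.cong) (auto simp: constant_point_def re_dir_def axis_def algebra_simps)
    then show ?thesis
      by (simp add: Suc fps_nth_Lax_fps fps_nth_resolvent)
  qed (simp add: fps_nth_Lax_fps fps_nth_resolvent dd.const)
qed

lemma Jacobian_constant_point:
  "Jacobian Lam (constant_point t) $ p $ q =
    of_real t * reduced_Jacobian Lam (constant_point t) $ p $ q"
proof -
  define G where "G = char_coeff_grad (knum (fst p)) (Lax_fps Lam (constant_point t))"
  define R where "R = resolvent_fps (of_real (Lam $ snd q))"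
  define N where "N = (\<chi> i j.
    R * fps_const (of_real t * ((if i = fst q then 1 else 0) + (if j = fst q then 1 else 0))))"
  have "trace (G ** N) = fps_const (of_real t) * (R * (\<Sum>i\<in>UNIV. G $ i $ fst q + G $ fst q $ i))"
    using exhaust_3[of "fst q"]
    by (auto simp: N_def trace_def matrix_matrix_mult_def sum_3 algebra_simps
        simp flip: fps_const_add)
  moreover have "Jacobian Lam (constant_point t) $ p $ q =
      fps_nth (trace (G ** N)) (Suc (idx (snd p)))"
    by (simp add: Jacobian_def dd_Ecoef dd_Lax_fps_constant_point G_def R_def N_def)
  ultimately show ?thesis
    by (simp add: reduced_Jacobian_def Let_def G_def R_def)
qed

lemma polynomial_function_det_reduced_Jacobian:
  fixes Lam :: "real^'n::finite"
  shows "polynomial_function (\<lambda>z. det (reduced_Jacobian Lam z))"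
proof (rule polynomial.closed_det)
  interpret coefficientwise: function_algebra
    "\<lambda>A :: complex^'n^3 \<Rightarrow> complex fps. \<forall>n. polynomial_function (\<lambda>z. fps_nth (A z) n)"
    by (rule polynomial.function_algebra_fps)
  fix p q
  show "polynomial_function (\<lambda>z. reduced_Jacobian Lam z $ p $ q)"
    unfolding reduced_Jacobian_def vec_lambda_beta Let_def
    by (rule spec, intro coefficientwise.closed_intros coefficientwise.closed_char_coeff_grad)
      (simp_all add: polynomial_function_Lax_fps)
qed

text \<open>Entry \<open>(i, j)\<close> is the coefficient of \<open>\<Sum>a. \<lambda>\<^sub>a ^ m * cmod \<phi>\<^sub>j\<^sub>a ^ 2\<close> in the quadratic part of the
  \<open>m\<close>-th integral belonging to \<open>p\<^sub>i\<close>.\<close>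
definition quadratic_part_coeff :: "complex^3^3" where
  "quadratic_part_coeff = (\<chi> i j. char_coeff_grad (knum i) Cmat $ j $ j)"

lemma det_quadratic_part_coeff_nonzero: "det quadratic_part_coeff \<noteq> 0"
  by (simp add: det_3 quadratic_part_coeff_def knum_def char_coeff_grad_def char_coeff_def trace_def
      sum_3 mat_def matrix_matrix_mult_def Cmat_def)

lemma char_coeff_grad_Lax_fps_0:
  "char_coeff_grad (knum k) (Lax_fps Lam 0) $ i $ j =
    (if i = j then fps_const (quadratic_part_coeff $ k $ i) else 0)"
  using exhaust_3[of i] exhaust_3[of j] exhaust_3[of k]
  by (auto simp: Lax_fps_def quadratic_part_coeff_def knum_def char_coeff_grad_def char_coeff_def
      trace_def sum_3 mat_def matrix_matrix_mult_def Cmat_def simp flip: fps_const_neg)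

lemma reduced_Jacobian_0:
  "reduced_Jacobian Lam 0 =
    kronecker (\<chi> i j. 2 * quadratic_part_coeff $ i $ j) (\<chi> a b. of_real (Lam$b) ^ idx a)"
proof -
  have "(\<Sum>i\<in>UNIV. (if i = j then fps_const (c i) else 0) + (if j = i then fps_const (c j) else 0)) =
      fps_const (2 * c j)"
    for c :: "3 \<Rightarrow> complex" and j
    by (simp add: sum.distrib)
  then show ?thesis
    by (simp add: vec_eq_iff reduced_Jacobian_def kronecker_def char_coeff_grad_Lax_fps_0
        fps_nth_resolvent)
qed

lemma bij_betw_idx: "bij_betw (idx :: 'n::finite \<Rightarrow> nat) UNIV {..<CARD('n)}"
proof -
  obtain h :: "'n \<Rightarrow> nat" where "bij_betw h UNIV {..<CARD('n)}"
    using ex_bij_betw_finite_nat[of "UNIV :: 'n set"] by (auto simp: atLeast0LessThan)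
  then show ?thesis unfolding idx_def
    by (rule someI[where P = "\<lambda>f. bij_betw f UNIV {..<CARD('n)}"])
qed

lemma det_reduced_Jacobian_0_nonzero:
  fixes Lam :: "real^'n::finite"
  assumes "inj (\<lambda>a. Lam $ a)"
  shows "det (reduced_Jacobian Lam 0) \<noteq> 0"
proof -
  have "(\<chi> i j. 2 * quadratic_part_coeff $ i $ j) = mat 2 ** quadratic_part_coeff"
    by (simp add: vec_eq_iff mat_mult_nth)
  then have "det (\<chi> i j. 2 * quadratic_part_coeff $ i $ j) \<noteq> 0"
    using det_quadratic_part_coeff_nonzero by (simp add: det_mul) (simp add: det_3 mat_def)
  moreover have "inj (\<lambda>a. complex_of_real (Lam $ a))"
    using assms by (simp add: inj_def)
  ultimately show ?thesis
    unfolding reduced_Jacobian_0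
    by (intro det_kronecker_nonzero det_Vandermonde_nonzero bij_betw_idx)
qed

lemma ex_det_Jacobian_nonzero:
  fixes Lam :: "real^'n::finite"
  assumes "inj (\<lambda>a. Lam $ a)"
  shows "\<exists>z. det (Jacobian Lam z) \<noteq> 0"
proof -
  have "(constant_point \<longlongrightarrow> (constant_point 0 :: complex^'n^3)) (at_right 0)"
    unfolding constant_point_def by (intro tendsto_intros)
  moreover have "constant_point 0 = (0 :: complex^'n^3)"
    by (simp add: constant_point_def vec_eq_iff)
  ultimately have lim: "(constant_point \<longlongrightarrow> (0 :: complex^'n^3)) (at_right 0)"
    by simp
  have "isCont (\<lambda>z. det (reduced_Jacobian Lam z)) 0"
    by (intro continuous_polymonial_function polynomial_function_det_reduced_Jacobian)
  from isCont_tendsto_compose[OF this lim]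
  have "((\<lambda>t. det (reduced_Jacobian Lam (constant_point t))) \<longlongrightarrow> det (reduced_Jacobian Lam 0))
      (at_right 0)" .
  then have "\<forall>\<^sub>F t in at_right 0. det (reduced_Jacobian Lam (constant_point t)) \<noteq> 0"
    using det_reduced_Jacobian_0_nonzero[OF assms] by (rule tendsto_imp_eventually_ne)
  then have "\<forall>\<^sub>F t in at_right 0. det (reduced_Jacobian Lam (constant_point t)) \<noteq> 0 \<and> t > 0"
    by (intro eventually_conj eventually_at_right_less)
  then obtain t where t: "det (reduced_Jacobian Lam (constant_point t)) \<noteq> 0" "t > 0"
    using eventually_happens'[of "at_right (0::real)"] trivial_limit_at_right_real by blast
  have "det (Jacobian Lam (constant_point t)) =
      of_real t ^ CARD(3 \<times> 'n) * det (reduced_Jacobian Lam (constant_point t))"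
    by (simp add: det_def Jacobian_constant_point prod.distrib sum_distrib_left mult_ac)
  with t show ?thesis by (intro exI[of _ "constant_point t"]) simp
qed

lemma cnj_Ecoef: "cnj (Ecoef Lam k m z) = Ecoef Lam k m z"
proof -
  let ?C = "char_coeff k (Lax_fps Lam z)"
  have "Lax Lam lam z = (\<chi> i j. cnj (Lax Lam (cnj lam) z $ j $ i))" for lam
    by (simp add: vec_eq_iff Lax_nth moment_def Cmat_def mult.commute)
  then have adjoint: "cnj (char_coeff k (Lax Lam (cnj lam) z)) = char_coeff k (Lax Lam lam z)"
    for lam
    by (metis char_coeff_adjoint)
  have expansion: "laurent_at_infinity (Rmax Lam) ?C (\<lambda>lam. char_coeff k (Lax Lam lam z))"
    by (intro laurent_at_infinity_char_coeff laurent_at_infinity_Lax)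
  have "Abs_fps (\<lambda>n. cnj (fps_nth ?C n)) = ?C"
    using laurent_at_infinity_cnj[OF Rmax_nonneg expansion] expansion adjoint
    by (rule laurent_at_infinity_unique)
  then show ?thesis by (simp add: Ecoef_eq fps_eq_iff)
qed

lemma Emap_derivative_rank:
  fixes Lam :: "real^'n::finite"
  assumes "det (Jacobian Lam z) \<noteq> 0"
  shows "\<exists>G. (Emap Lam has_derivative G) (at z) \<and> dim (range G) = 3 * CARD('n)"
proof -
  define E where "E p = Ecoef Lam (knum (fst p)) (idx (snd p))" for p :: "3 \<times> 'n"
  define G where "G v = (\<chi> p. dd (E p) z v)" for v
  have "((\<lambda>z. \<chi> p. E p z) has_derivative G) (at z)"
    unfolding G_def
    by (intro has_derivative_vec_lambda differentiable_has_derivative_dd) (simp add: E_def)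
  then have deriv: "(Emap Lam has_derivative G) (at z)"
    by (simp add: E_def Emap_def[abs_def])
  have "Im (E p x) = 0" for p x
    using cnj_Ecoef[of Lam "knum (fst p)" "idx (snd p)" x] by (simp add: E_def complex_eq_iff)
  then have "Im (G v $ p) = 0" for v p
    unfolding G_def vec_lambda_beta by (intro Im_dd_eq_0_if_real_valued) (simp_all add: E_def)
  then have "dim (range G) \<le> CARD(3 \<times> 'n)"
    by (rule dim_range_le_if_real_valued)
  moreover have "det (\<chi> p q. G (re_dir (fst q) (snd q)) $ p) \<noteq> 0"
    using assms by (simp add: Jacobian_def G_def E_def)
  then have "CARD(3 \<times> 'n) \<le> dim (range G)"
    by (rule dim_range_ge_if_det_nonzero[OF has_derivative_linear[OF deriv]])
  ultimately show ?thesis using deriv by (intro exI[of _ G]) simp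
qed

lemma functional_independence:
  fixes Lam :: "real^'n::finite"
  assumes "inj (\<lambda>a. Lam $ a)"
  shows "\<exists>S. open S \<and> closure S = UNIV \<and>
    (\<forall>z\<in>S. \<exists>G'. (Emap Lam has_derivative G') (at z) \<and> dim (range G') = 3 * CARD('n))"
proof (intro exI[of _ "{z. det (Jacobian Lam z) \<noteq> 0}"] conjI ballI)
  show "open {z. det (Jacobian Lam z) \<noteq> 0}"
    by (intro open_Collect_neq continuous_on_const continuous_on_polymonial_function
        polynomial_function_det_Jacobian)
  show "closure {z. det (Jacobian Lam z) \<noteq> 0} = UNIV"
    using ex_det_Jacobian_nonzero[OF assms]
      nonzero_polynomial_function_dense[OF polynomial_function_det_Jacobian] by blast
qed (simp add: Emap_derivative_rank)

subsection \<open>The Davey--Stewartson I equation\<close>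

lemma ham_flow_velocity:
  fixes F :: "real \<times> real \<times> real \<Rightarrow> complex^'n::finite^3"
  assumes flow: "ham_flow H e U F" and "p \<in> U" and F: "(F has_derivative F') (at p)"
  shows "F' e $ j $ a = - \<i> * dphibar H (F p) j a"
    and "cnj (F' e $ j $ a) = \<i> * dphi H (F p) j a"
proof -
  have "dd (\<lambda>q. F q $ j $ a) p e = F' e $ j $ a"
    "dd (\<lambda>q. cnj (F q $ j $ a)) p e = cnj (F' e $ j $ a)"
    by (simp_all add: dd_compose[OF _ F, of "\<lambda>z. z$j$a"] dd_compose[OF _ F, of "\<lambda>z. cnj (z$j$a)"]
        dd_coord dd_cnj_coord)
  then have "\<i> * F' e $ j $ a = dphibar H (F p) j a" "- \<i> * cnj (F' e $ j $ a) = dphi H (F p) j a"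
    using flow \<open>p \<in> U\<close> unfolding ham_flow_def by metis+
  moreover have "w = - \<i> * (\<i> * w)" "w = \<i> * (- \<i> * w)" for w
    by (simp_all flip: mult.assoc)
  ultimately show "F' e $ j $ a = - \<i> * dphibar H (F p) j a"
    "cnj (F' e $ j $ a) = \<i> * dphi H (F p) j a"
    by metis+
qed

lemma dd_along_flow:
  fixes F :: "real \<times> real \<times> real \<Rightarrow> complex^'n::finite^3"
  assumes f: "f differentiable (at (F p))" and flow: "ham_flow H e U F" "p \<in> U"
    and F: "(F has_derivative F') (at p)"
  shows "dd (\<lambda>q. f (F q)) p e = PB f H (F p)"
  unfolding dd_compose[where f = f, OF f F] dd_Wirtinger[OF f] ham_flow_velocity(2)[OF flow F]
  unfolding ham_flow_velocity(1)[OF flow F] PB_def sum_distrib_left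
  by (intro sum.cong refl) (simp add: algebra_simps)

lemma dd_dd_along_flow:
  fixes F :: "real \<times> real \<times> real \<Rightarrow> complex^'n::finite^3"
  assumes f: "\<And>z. f differentiable (at z)" and g: "\<And>z. g differentiable (at z)" and "PB f H = g"
    and flow: "ham_flow H e U F" and U: "open U" "p \<in> U"
    and F: "\<And>q. q \<in> U \<Longrightarrow> (F has_derivative F' q) (at q)"
  shows "dd (\<lambda>q. dd (\<lambda>q. f (F q)) q e) p e = PB g H (F p)"
proof -
  have "dd (\<lambda>q. dd (\<lambda>q. f (F q)) q e) p e = dd (\<lambda>q. g (F q)) p e"
    using dd_along_flow[OF f flow _ F] \<open>PB f H = g\<close> by (intro dd_cong_open[OF U]) simp
  also have "\<dots> = PB g H (F p)"
    by (rule dd_along_flow[OF g flow U(2) F[OF U(2)]])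
  finally show ?thesis .
qed

definition ds_u :: "real^'n::finite \<Rightarrow> complex^'n^3 \<Rightarrow> complex" where
  "ds_u Lam z = \<i> * ip Lam 0 (z$2) (z$1)"

definition ds_v :: "real^'n::finite \<Rightarrow> 3 \<Rightarrow> complex^'n^3 \<Rightarrow> complex" where
  "ds_v Lam j z = 2 * sqabs (ip Lam 0 (z$3) (z$j))"

lemma sqabs_i_mult: "sqabs (\<i> * w) = sqabs w"
  by (simp add: sqabs_def norm_mult)

lemma ds_power_moment:
  shows "ds_u Lam = (\<lambda>z. \<i> * power_moment Lam 0 1 2 z)"
    and "ds_v Lam j = (\<lambda>z. 2 * (power_moment Lam 0 j 3 z * power_moment Lam 0 3 j z))"
  unfolding ds_u_def[abs_def] ds_v_def[abs_def] ip_eq_power_moment sqabs_power_moment by simp_all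

lemma sqabs_ds_u: "sqabs (ds_u Lam z) = power_moment Lam 0 1 2 z * power_moment Lam 0 2 1 z"
  by (simp add: ds_power_moment sqabs_i_mult sqabs_power_moment)

lemma PB_power_moment:
  "PB (power_moment Lam m i j) (power_moment Lam n k l) z =
    - \<i> * ((if i = l then power_moment Lam (m + n) k j z else 0)
      - (if j = k then power_moment Lam (m + n) i l z else 0))"
  by (simp add: power_moment_def PB_moment power_add)

lemmas PB_Hamiltonians_simps =
  Hamiltonians_power_moment PB_left.rules PB_right.rules PB_power_moment

lemma PB_ds_u_Hx:
  "PB (ds_u Lam) (Hx Lam) = (\<lambda>z. - 2 * (power_moment Lam 0 1 3 z * power_moment Lam 0 3 2 z))"
  unfolding ds_power_moment by (rule ext) (simp add: PB_Hamiltonians_simps algebra_simps)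

lemma PB_ds_u_Hy:
  "PB (ds_u Lam) (Hy Lam) = (\<lambda>z. - 2 * power_moment Lam 1 1 2 z
    + (power_moment Lam 0 1 1 z - power_moment Lam 0 2 2 z) * power_moment Lam 0 1 2 z)"
  unfolding ds_power_moment by (rule ext) (simp add: PB_Hamiltonians_simps algebra_simps)

lemma DSI_bracket_identities:
  shows "- \<i> * PB (ds_u Lam) (Ht Lam) z = PB (PB (ds_u Lam) (Hx Lam)) (Hx Lam) z
      + PB (PB (ds_u Lam) (Hy Lam)) (Hy Lam) z + 2 * sqabs (ds_u Lam z) * ds_u Lam z
      + 2 * (ds_v Lam 1 z + ds_v Lam 2 z) * ds_u Lam z"
    and "PB (ds_v Lam 1) (Hx Lam) z - PB (ds_v Lam 1) (Hy Lam) z =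
      - PB (\<lambda>z. sqabs (ds_u Lam z)) (Hx Lam) z"
    and "PB (ds_v Lam 2) (Hx Lam) z + PB (ds_v Lam 2) (Hy Lam) z =
      - PB (\<lambda>z. sqabs (ds_u Lam z)) (Hx Lam) z"
  unfolding PB_ds_u_Hx PB_ds_u_Hy sqabs_ds_u unfolding ds_power_moment
  by (simp_all add: PB_Hamiltonians_simps algebra_simps)

lemma DSI_solution:
  fixes Lam :: "real^'n::finite" and F :: "real \<times> real \<times> real \<Rightarrow> complex^'n^3"
  assumes U: "open U" and smooth: "smooth_on U F"
    and flow_x: "ham_flow (Hx Lam) ex U F" and flow_y: "ham_flow (Hy Lam) ey U F"
    and flow_t: "ham_flow (Ht Lam) et U F"
  shows "DSI U (\<lambda>q. ds_u Lam (F q)) (\<lambda>q. ds_v Lam 1 (F q)) (\<lambda>q. ds_v Lam 2 (F q))"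
proof -
  have "Ck (Suc 0) U F" using smooth unfolding smooth_on_def by blast
  then obtain F' where F': "\<And>q. q \<in> U \<Longrightarrow> (F has_derivative F' q) (at q)" by auto
  have [simp]: "polynomial_function (ds_u Lam)" "polynomial_function (ds_v Lam j)"
    "polynomial_function (\<lambda>z. sqabs (ds_u Lam z))" for j
    by (simp_all add: sqabs_ds_u) (simp_all add: ds_power_moment)
  have dx: "dd (\<lambda>q. f (F q)) p ex = PB f (Hx Lam) (F p)"
    and dy: "dd (\<lambda>q. f (F q)) p ey = PB f (Hy Lam) (F p)"
    and dt: "dd (\<lambda>q. f (F q)) p et = PB f (Ht Lam) (F p)"
    if "polynomial_function f" "p \<in> U" for f p
    using that by (auto intro: dd_along_flow[OF _ flow_x _ F'] dd_along_flow[OF _ flow_y _ F']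
        dd_along_flow[OF _ flow_t _ F'])
  have dxx: "dd (\<lambda>q. dd (\<lambda>q. ds_u Lam (F q)) q ex) p ex =
      PB (PB (ds_u Lam) (Hx Lam)) (Hx Lam) (F p)"
    and dyy: "dd (\<lambda>q. dd (\<lambda>q. ds_u Lam (F q)) q ey) p ey =
      PB (PB (ds_u Lam) (Hy Lam)) (Hy Lam) (F p)"
    if "p \<in> U" for p
    using that F' U by (auto intro!: dd_dd_along_flow flow_x flow_y simp: PB_ds_u_Hx PB_ds_u_Hy)
  show ?thesis
    unfolding DSI_def
  proof (intro ballI conjI)
    fix p assume p: "p \<in> U"
    have sq: "dd (\<lambda>q. sqabs (ds_u Lam (F q))) p ex = PB (\<lambda>z. sqabs (ds_u Lam z)) (Hx Lam) (F p)"
      by (rule dx[OF _ p]) simp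
    show "- \<i> * dd (\<lambda>q. ds_u Lam (F q)) p et = dd (\<lambda>q. dd (\<lambda>q. ds_u Lam (F q)) q ex) p ex
        + dd (\<lambda>q. dd (\<lambda>q. ds_u Lam (F q)) q ey) p ey + 2 * sqabs (ds_u Lam (F p)) * ds_u Lam (F p)
        + 2 * (ds_v Lam 1 (F p) + ds_v Lam 2 (F p)) * ds_u Lam (F p)"
      using p by (simp only: dt dxx dyy DSI_bracket_identities \<open>polynomial_function (ds_u Lam)\<close>)
    show "dd (\<lambda>q. ds_v Lam 1 (F q)) p ex - dd (\<lambda>q. ds_v Lam 1 (F q)) p ey =
        - dd (\<lambda>q. sqabs (ds_u Lam (F q))) p ex"
      using p by (simp add: dx dy sq DSI_bracket_identities)
    show "dd (\<lambda>q. ds_v Lam 2 (F q)) p ex + dd (\<lambda>q. ds_v Lam 2 (F q)) p ey =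
        - dd (\<lambda>q. sqabs (ds_u Lam (F q))) p ex"
      using p by (simp add: dx dy sq DSI_bracket_identities)
  qed
qed

theorem theorem1:
  fixes Lam :: "real^'n::finite"
  assumes distinct: "inj (\<lambda>a. Lam $ a)"
    and nonzero: "\<And>a. Lam $ a \<noteq> 0"
  shows
    "PB (Hx Lam) (Hy Lam) = (\<lambda>z. 0) \<and> PB (Hx Lam) (Ht Lam) = (\<lambda>z. 0) \<and>
     PB (Hy Lam) (Ht Lam) = (\<lambda>z. 0)
   \<and> (\<forall>k\<in>{1,2,3}. \<forall>k'\<in>{1,2,3}. \<forall>m<CARD('n). \<forall>m'<CARD('n).
        PB (Ecoef Lam k m) (Ecoef Lam k' m') = (\<lambda>z. 0))
   \<and> (\<forall>k\<in>{1,2,3}. \<forall>m<CARD('n).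
        PB (Ecoef Lam k m) (Hx Lam) = (\<lambda>z. 0) \<and>
        PB (Ecoef Lam k m) (Hy Lam) = (\<lambda>z. 0) \<and>
        PB (Ecoef Lam k m) (Ht Lam) = (\<lambda>z. 0))
   \<and> (\<exists>S. open S \<and> closure S = UNIV \<and>
        (\<forall>z\<in>S. \<exists>G'. (Emap Lam has_derivative G') (at z) \<and> dim (range G') = 3 * CARD('n)))
   \<and> (\<forall>U F. open U \<and> smooth_on U F \<and>
        ham_flow (Hx Lam) ex U F \<and> ham_flow (Hy Lam) ey U F \<and> ham_flow (Ht Lam) et U F \<longrightarrow>
        DSI U (\<lambda>q. \<i> * ip Lam 0 (F q $ 2) (F q $ 1))
              (\<lambda>q. 2 * sqabs (ip Lam 0 (F q $ 3) (F q $ 1)))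
              (\<lambda>q. 2 * sqabs (ip Lam 0 (F q $ 3) (F q $ 2))))"
proof (intro conjI ballI allI impI)
  show "PB (Hx Lam) (Hy Lam) = (\<lambda>z. 0)" "PB (Hx Lam) (Ht Lam) = (\<lambda>z. 0)"
    "PB (Hy Lam) (Ht Lam) = (\<lambda>z. 0)"
    by (auto intro: PB_Hamiltonians_eq_0 PB_Hamiltonians_Ecoef)
  fix k m
  show "PB (Ecoef Lam k m) (Ecoef Lam k' m') = (\<lambda>z. 0)" for k' m'
    by (rule ext) (rule PB_Ecoef)
  show "PB (Ecoef Lam k m) (Hx Lam) = (\<lambda>z. 0)" "PB (Ecoef Lam k m) (Hy Lam) = (\<lambda>z. 0)"
    "PB (Ecoef Lam k m) (Ht Lam) = (\<lambda>z. 0)"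
    by (auto intro: PB_Hamiltonians_eq_0 PB_Ecoef)
next
  show "\<exists>S. open S \<and> closure S = UNIV \<and>
      (\<forall>z\<in>S. \<exists>G'. (Emap Lam has_derivative G') (at z) \<and> dim (range G') = 3 * CARD('n))"
    by (rule functional_independence[OF distinct])
next
  fix U and F :: "real \<times> real \<times> real \<Rightarrow> complex^'n^3"
  assume "open U \<and> smooth_on U F \<and>
    ham_flow (Hx Lam) ex U F \<and> ham_flow (Hy Lam) ey U F \<and> ham_flow (Ht Lam) et U F"
  then show "DSI U (\<lambda>q. \<i> * ip Lam 0 (F q $ 2) (F q $ 1))
      (\<lambda>q. 2 * sqabs (ip Lam 0 (F q $ 3) (F q $ 1)))
      (\<lambda>q. 2 * sqabs (ip Lam 0 (F q $ 3) (F q $ 2)))"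
    using DSI_solution[of U F Lam, unfolded ds_u_def ds_v_def] by blast
qed

end
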